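(* Let $n\ge2$, let $\Omega_0\subset\mathbb R^n$ be a bounded convex domain, $x_0\in\Omega_0$, $\Omega=\Omega_0\setminus\{x_0\}$, and let $u$ be the $\infty$-harmonic potential of $\Omega$ (i.e. $u=0$ on $\partial\Omega_0$, $u(x_0)=1$). The following are equivalent: (i) $\Omega_0=B(x_0,r)$ for some $r>0$; (ii) $u\in C^2(\Omega)$; (iii) $u$ is concave on $\Omega_0$.
   Context: The $\infty$-harmonic potential of $\Omega=\Omega_0\setminus\{x_0\}$ is the unique $u\in C^0(\overline{\Omega_0})$ which is a viscosity solution (Crandall–Ishii–Lions sense) of $\Delta_\infty u:=\langle D^2u\,Du,Du\rangle=0$ in $\Omega$ with $u=0$ on $\partial\Omega_0$ and $u(x_0)=1$. *)

theory Defs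
  imports "HOL-Analysis.Analysis"
begin

definition C2_data ::
  "(real^'n) set \<Rightarrow> (real^'n \<Rightarrow> real) \<Rightarrow> (real^'n \<Rightarrow> real^'n)
     \<Rightarrow> (real^'n \<Rightarrow> real^'n \<Rightarrow> real^'n) \<Rightarrow> bool" where
  "C2_data S f g H \<longleftrightarrow>
     (\<forall>x\<in>S. (f has_derivative (\<lambda>h. g x \<bullet> h)) (at x) \<and> (g has_derivative H x) (at x))
     \<and> (\<forall>v. continuous_on S (\<lambda>x. H x v))"

definition C2_on :: "(real^'n) set \<Rightarrow> (real^'n \<Rightarrow> real) \<Rightarrow> bool" where
  "C2_on S f \<longleftrightarrow> (\<exists>g H. C2_data S f g H)"

definition inf_lap :: "(real^'n \<Rightarrow> real^'n) \<Rightarrow> (real^'n \<Rightarrow> real^'n \<Rightarrow> real^'n) \<Rightarrow> real^'n \<Rightarrow> real" where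
  "inf_lap g H x = H x (g x) \<bullet> g x"

definition inf_visc_sub :: "(real^'n) set \<Rightarrow> (real^'n \<Rightarrow> real) \<Rightarrow> bool" where
  "inf_visc_sub U u \<longleftrightarrow>
     (\<forall>x\<in>U. \<forall>S \<phi> g H. open S \<and> x \<in> S \<and> S \<subseteq> U \<and> C2_data S \<phi> g H \<and>
        (\<forall>y\<in>S. u y - \<phi> y \<le> u x - \<phi> x) \<longrightarrow> inf_lap g H x \<ge> 0)"

definition inf_visc_super :: "(real^'n) set \<Rightarrow> (real^'n \<Rightarrow> real) \<Rightarrow> bool" where
  "inf_visc_super U u \<longleftrightarrow>
     (\<forall>x\<in>U. \<forall>S \<phi> g H. open S \<and> x \<in> S \<and> S \<subseteq> U \<and> C2_data S \<phi> g H \<and>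
        (\<forall>y\<in>S. u y - \<phi> y \<ge> u x - \<phi> x) \<longrightarrow> inf_lap g H x \<le> 0)"

definition inf_harmonic_visc :: "(real^'n) set \<Rightarrow> (real^'n \<Rightarrow> real) \<Rightarrow> bool" where
  "inf_harmonic_visc U u \<longleftrightarrow>
     continuous_on U u \<and> inf_visc_sub U u \<and> inf_visc_super U u"

definition inf_harmonic_potential ::
  "(real^'n) set \<Rightarrow> real^'n \<Rightarrow> (real^'n \<Rightarrow> real) \<Rightarrow> bool" where
  "inf_harmonic_potential \<Omega>0 x0 u \<longleftrightarrow>
     continuous_on (closure \<Omega>0) u \<and> (\<forall>x\<in>frontier \<Omega>0. u x = 0) \<and> u x0 = 1 \<and>
     inf_harmonic_visc (\<Omega>0 - {x0}) u"

end

theory Submission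
  imports Defs
begin

text \<open>
Let \<open>r\<close> be the distance from \<open>x0\<close> to the boundary. Comparison with cones (from \<open>x0\<close>, from boundary points
and from interior points) shows that \<open>u\<close> is \<open>1/r\<close>-Lipschitz, that \<open>u = 1 - t/r\<close> along the segment to a nearest
boundary point, and that \<open>1 - u \<ge> |Du| |x - x0|\<close>. The domain is the ball of radius \<open>r\<close> as soon as
\<open>1 - u \<ge> |x - x0| / r\<close>. Asymptotically at \<open>x0\<close> this always holds: tilting a cone by a linear function gives a
strict supersolution off the tilting axis, which yields a strong maximum principle for the blow-ups of \<open>u\<close>.
If \<open>u\<close> is concave, the slope \<open>(1 - u) / |x - x0|\<close> increases along rays and the asymptotic bound is global.
If \<open>u\<close> is twice continuously differentiable, then \<open>|Du|\<close> is constant along gradient curves and \<open>\<nabla>|Du|\<close> is their curvature up to a factor.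
A Hopf type argument excludes critical points; the gradient curves on which \<open>|Du|\<close> is minimal are then straight
segments ending at \<open>x0\<close>, so that the minimum of \<open>|Du|\<close> is the asymptotic slope \<open>1/r\<close>. The statements about
gradient curves are implemented as minimum principles for functions such as \<open>|Du|\<^sup>2 + \<kappa> exp (N u)\<close>, so no
differential equation is solved.
\<close>


subsection \<open>Second derivatives and cone test functions\<close>

text \<open>Cones solve the equation themselves, so touching a cone never contradicts it; a
  comparison becomes strict only after a perturbation. Away from the pole a small quadratic
  suffices. At the pole the quadratic competes with a cone whose curvature acts only orthogonally to
  the radius, while its gradient is radial; the linear tilt gives the gradient a tangential part, on
  which the curvature of order \<open>A / |x - x0|\<close> acts. This degenerates on the axis of the
  tilt, and most constants serve to keep the asymptotic maximum away from both ends of that axis.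
  For smooth u the function |Du|^2 is only C^1, so its minimum principles are of first order: they
  use Du . D|Du|^2 = 0 and a perturbation that is strictly monotone along Du. They break down where
  Du = 0, which is why critical points are excluded beforehand, by an argument that needs second
  order information about |Du|^2 but extracts it along one explicit curve.\<close>

lemma C2_data_subset: "C2_data S f g H \<Longrightarrow> T \<subseteq> S \<Longrightarrow> C2_data T f g H"
  unfolding C2_data_def by (meson continuous_on_subset subsetD)

lemma C2_data_minus:
  assumes "C2_data S f g H"
  shows "C2_data S (\<lambda>x. - f x) (\<lambda>x. - g x) (\<lambda>x h. - H x h)"
  unfolding C2_data_def
proof (intro conjI ballI allI)
  fix x assume x: "x \<in> S"
  show "((\<lambda>x. - f x) has_derivative (\<lambda>h. - g x \<bullet> h)) (at x)"
    using has_derivative_minus[of f "\<lambda>h. g x \<bullet> h" "at x"] assms x by (simp add: C2_data_def)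
  show "((\<lambda>x. - g x) has_derivative (\<lambda>h. - H x h)) (at x)"
    using has_derivative_minus[of g "H x" "at x"] assms x by (simp add: C2_data_def)
next
  fix v show "continuous_on S (\<lambda>x. - H x v)"
    using assms by (simp add: C2_data_def continuous_on_minus)
qed

lemma C2_data_linear: "C2_data S f g H \<Longrightarrow> x \<in> S \<Longrightarrow> bounded_linear (H x)"
  by (auto simp: C2_data_def intro: has_derivative_bounded_linear)

text \<open>One family serves all uses: \<open>b = 0\<close> and \<open>p = z\<close> in the
  comparison with cones, \<open>b\<close> a tilt at the pole, and \<open>b = 0\<close>,
  \<open>E = 0\<close> for the explicit solution on a ball.\<close>

lemma C2_data_cone:
  fixes z p b :: "real^'n"
  shows "C2_data (- {z}) (\<lambda>x. k + b \<bullet> x + A * norm (x - z) + E * (norm (x - p))\<^sup>2)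
     (\<lambda>x. b + (A / norm (x - z)) *\<^sub>R (x - z) + (2 * E) *\<^sub>R (x - p))
     (\<lambda>x h. (A / norm (x - z)) *\<^sub>R h - (A * ((x - z) \<bullet> h) / norm (x - z) ^ 3) *\<^sub>R (x - z)
        + (2 * E) *\<^sub>R h)"
proof -
  have N: "((\<lambda>x. norm (x - z)) has_derivative (\<lambda>h. (x - z) \<bullet> h / norm (x - z))) (at x)"
    if "x \<noteq> z" for x
  proof -
    have "((\<lambda>x. norm (x - z)) has_derivative (\<lambda>h. h \<bullet> sgn (x - z))) (at x)"
      using that by (intro has_derivative_compose[OF _ has_derivative_norm, of "\<lambda>x. x - z" "\<lambda>h. h"])
        (auto intro!: derivative_eq_intros)
    then show ?thesis by (simp add: sgn_div_norm inner_commute divide_inverse mult.commute)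
  qed
  have "((\<lambda>x. k + b \<bullet> x + A * norm (x - z) + E * (norm (x - p))\<^sup>2) has_derivative
          (\<lambda>h. (b + (A / norm (x - z)) *\<^sub>R (x - z) + (2 * E) *\<^sub>R (x - p)) \<bullet> h)) (at x)"
    if "x \<noteq> z" for x
  proof -
    have "((\<lambda>x. k + b \<bullet> x + A * norm (x - z) + E * (norm (x - p))\<^sup>2) has_derivative
          (\<lambda>h. b \<bullet> h + A * ((x - z) \<bullet> h / norm (x - z)) + E * ((x - p) \<bullet> h + h \<bullet> (x - p)))) (at x)"
      unfolding power2_norm_eq_inner
      by (rule derivative_eq_intros N that refl | simp)+
    then show ?thesis
      by (rule has_derivative_eq_rhs) (simp add: fun_eq_iff inner_add_left inner_commute[of _ "x - p"])
  qed
  moreover have "((\<lambda>x. b + (A / norm (x - z)) *\<^sub>R (x - z) + (2 * E) *\<^sub>R (x - p)) has_derivative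
     (\<lambda>h. (A / norm (x - z)) *\<^sub>R h - (A * ((x - z) \<bullet> h) / norm (x - z) ^ 3) *\<^sub>R (x - z)
        + (2 * E) *\<^sub>R h)) (at x)"
    if "x \<noteq> z" for x
  proof -
    have I: "((\<lambda>x. A / norm (x - z)) has_derivative (\<lambda>h. - (A * ((x - z) \<bullet> h) / norm (x - z) ^ 3))) (at x)"
      using that by (auto intro!: derivative_eq_intros N simp: fun_eq_iff field_simps power3_eq_cube)
    show ?thesis
      by (rule derivative_eq_intros I refl | simp)+
  qed
  moreover have "continuous_on (- {z}) (\<lambda>x. (A / norm (x - z)) *\<^sub>R h
      - (A * ((x - z) \<bullet> h) / norm (x - z) ^ 3) *\<^sub>R (x - z) + (2 * E) *\<^sub>R h)" for h
    by (intro continuous_intros) auto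
  ultimately show ?thesis
    by (simp add: C2_data_def)
qed

text \<open>For \<open>n\<close> the norm of \<open>y\<close>, the two terms with \<open>A\<close>
  combine to \<open>A / n\<close> times the squared component of \<open>v\<close> orthogonal to
  \<open>y\<close>: a cone curves only tangentially.\<close>

lemma inf_lap_cone:
  fixes y v :: "real^'n"
  shows "((A / n) *\<^sub>R v - (A * (y \<bullet> v) / n ^ 3) *\<^sub>R y + (2 * E) *\<^sub>R v) \<bullet> v
    = A / n * (v \<bullet> v) - A * (y \<bullet> v)\<^sup>2 / n ^ 3 + 2 * E * (v \<bullet> v)"
  by (simp add: inner_simps power2_eq_square)

text \<open>\<open>C2_data\<close> asks for continuity of \<open>H\<close> in one fixed direction at
  a time. Expanding the direction in the finite basis upgrades this to joint continuity in point and
  direction.\<close>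

lemma C2_data_tendsto:
  fixes f :: "real^'n \<Rightarrow> real"
  assumes C: "C2_data S f g H" and "open S" "x \<in> S"
    and p: "(p \<longlongrightarrow> x) F" and w: "(w \<longlongrightarrow> w0) F"
  shows "((\<lambda>t. H (p t) (w t)) \<longlongrightarrow> H x w0) F"
proof -
  have lin: "H y v = (\<Sum>i\<in>Basis. (v \<bullet> i) *\<^sub>R H y i)" if "y \<in> S" for y v
  proof -
    interpret bounded_linear "H y" by (rule C2_data_linear[OF C that])
    have "H y v = H y (\<Sum>i\<in>Basis. (v \<bullet> i) *\<^sub>R i)" by (simp add: euclidean_representation)
    also have "\<dots> = (\<Sum>i\<in>Basis. (v \<bullet> i) *\<^sub>R H y i)" by (simp add: sum scaleR)
    finally show ?thesis .
  qed
  have "((\<lambda>t. H (p t) i) \<longlongrightarrow> H x i) F" for i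
    using C p \<open>open S\<close> \<open>x \<in> S\<close> unfolding C2_data_def
    by (intro isCont_tendsto_compose[OF _ p]) (auto simp: continuous_on_eq_continuous_at)
  then have "((\<lambda>t. \<Sum>i\<in>Basis. (w t \<bullet> i) *\<^sub>R H (p t) i) \<longlongrightarrow> (\<Sum>i\<in>Basis. (w0 \<bullet> i) *\<^sub>R H x i)) F"
    by (intro tendsto_intros w)
  moreover have "eventually (\<lambda>t. p t \<in> S) F"
    using p \<open>open S\<close> \<open>x \<in> S\<close> by (rule topological_tendstoD)
  then have "eventually (\<lambda>t. (\<Sum>i\<in>Basis. (w t \<bullet> i) *\<^sub>R H (p t) i) = H (p t) (w t)) F"
    by (rule eventually_mono) (rule lin[symmetric])
  ultimately show ?thesis
    by (subst lin[OF \<open>x \<in> S\<close>]) (rule Lim_transform_eventually)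
qed

text \<open>Two applications of the mean value theorem, first along \<open>w\<close> and then along
  \<open>v\<close>, turn the mixed difference into a value of \<open>H\<close> at a nearby
  point.\<close>

lemma C2_second_difference:
  fixes f :: "real^'n \<Rightarrow> real"
  assumes C: "C2_data S f g H" and sub: "ball x e \<subseteq> S" and t: "0 < t" "t * (norm v + norm w) < e"
  obtains y where "norm (y - x) \<le> t * (norm v + norm w)"
    "f (x + t *\<^sub>R v + t *\<^sub>R w) - f (x + t *\<^sub>R v) - f (x + t *\<^sub>R w) + f x = t\<^sup>2 * (H y v \<bullet> w)"
proof -
  have nrm: "norm (a *\<^sub>R v + b *\<^sub>R w) \<le> t * (norm v + norm w)" if "0 \<le> a" "a \<le> t" "0 \<le> b" "b \<le> t" for a b
  proof -
    have "norm (a *\<^sub>R v + b *\<^sub>R w) \<le> a * norm v + b * norm w"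
      using that norm_triangle_ineq[of "a *\<^sub>R v" "b *\<^sub>R w"] by simp
    also have "\<dots> \<le> t * norm v + t * norm w"
      using that by (intro add_mono mult_right_mono) auto
    finally show ?thesis by (simp add: algebra_simps)
  qed
  have inS: "x + a *\<^sub>R v + b *\<^sub>R w \<in> S" if "0 \<le> a" "a \<le> t" "0 \<le> b" "b \<le> t" for a b
  proof -
    have "dist x (x + a *\<^sub>R v + b *\<^sub>R w) = norm (a *\<^sub>R v + b *\<^sub>R w)"
      by (subst dist_commute) (simp add: dist_norm)
    then show ?thesis using nrm[OF that] t sub by (intro subsetD[OF sub]) simp
  qed
  have df: "(f has_derivative (\<lambda>h. g y \<bullet> h)) (at y)" "(g has_derivative H y) (at y)" if "y \<in> S" for y
    using C that unfolding C2_data_def by auto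
  define \<phi> where "\<phi> b = f (x + t *\<^sub>R v + b *\<^sub>R w) - f (x + 0 *\<^sub>R v + b *\<^sub>R w)" for b
  have "\<exists>b. 0 < b \<and> b < t \<and> \<phi> t - \<phi> 0 = (t - 0) * (g (x + t *\<^sub>R v + b *\<^sub>R w) \<bullet> w - g (x + 0 *\<^sub>R v + b *\<^sub>R w) \<bullet> w)"
  proof (rule MVT2[OF t(1)])
    fix b assume b: "0 \<le> b" "b \<le> t"
    have *: "((\<lambda>b. f (x + a *\<^sub>R v + b *\<^sub>R w)) has_real_derivative g (x + a *\<^sub>R v + b *\<^sub>R w) \<bullet> w) (at b)"
      if "0 \<le> a" "a \<le> t" for a
    proof -
      have "((\<lambda>b. x + a *\<^sub>R v + b *\<^sub>R w) has_derivative (\<lambda>h. h *\<^sub>R w)) (at b)"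
        by (auto intro!: derivative_eq_intros)
      from has_derivative_compose[OF this df(1)[OF inS[OF that b]]]
      show ?thesis unfolding has_field_derivative_def
        by (rule has_derivative_eq_rhs) (simp add: fun_eq_iff)
    qed
    show "(\<phi> has_real_derivative g (x + t *\<^sub>R v + b *\<^sub>R w) \<bullet> w - g (x + 0 *\<^sub>R v + b *\<^sub>R w) \<bullet> w) (at b)"
      unfolding \<phi>_def using t by (intro DERIV_diff *) auto
  qed
  then obtain b where b: "0 < b" "b < t"
    and eq1: "\<phi> t - \<phi> 0 = t * (g (x + t *\<^sub>R v + b *\<^sub>R w) \<bullet> w - g (x + 0 *\<^sub>R v + b *\<^sub>R w) \<bullet> w)"
    by auto
  have "\<exists>a. 0 < a \<and> a < t \<and> g (x + t *\<^sub>R v + b *\<^sub>R w) \<bullet> w - g (x + 0 *\<^sub>R v + b *\<^sub>R w) \<bullet> w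
      = (t - 0) * (H (x + a *\<^sub>R v + b *\<^sub>R w) v \<bullet> w)"
  proof (rule MVT2[OF t(1)])
    fix a assume a: "0 \<le> a" "a \<le> t"
    have "((\<lambda>a. x + a *\<^sub>R v + b *\<^sub>R w) has_derivative (\<lambda>h. h *\<^sub>R v)) (at a)"
      by (auto intro!: derivative_eq_intros)
    from has_derivative_compose[OF this df(2)[OF inS[OF a less_imp_le[OF b(1)] less_imp_le[OF b(2)]]]]
    have "((\<lambda>a. g (x + a *\<^sub>R v + b *\<^sub>R w)) has_derivative (\<lambda>h. H (x + a *\<^sub>R v + b *\<^sub>R w) (h *\<^sub>R v))) (at a)" .
    then have "((\<lambda>a. g (x + a *\<^sub>R v + b *\<^sub>R w) \<bullet> w) has_derivative
        (\<lambda>h. H (x + a *\<^sub>R v + b *\<^sub>R w) (h *\<^sub>R v) \<bullet> w)) (at a)"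
      by (rule has_derivative_inner_left)
    moreover have "H (x + a *\<^sub>R v + b *\<^sub>R w) (h *\<^sub>R v) = h *\<^sub>R H (x + a *\<^sub>R v + b *\<^sub>R w) v" for h
      using b by (intro linear_cmul bounded_linear.linear C2_data_linear[OF C] inS[OF a]) auto
    ultimately show "((\<lambda>a. g (x + a *\<^sub>R v + b *\<^sub>R w) \<bullet> w) has_real_derivative H (x + a *\<^sub>R v + b *\<^sub>R w) v \<bullet> w) (at a)"
      unfolding has_field_derivative_def by (elim has_derivative_eq_rhs) (simp add: fun_eq_iff)
  qed
  then obtain a where a: "0 < a" "a < t"
    and eq2: "g (x + t *\<^sub>R v + b *\<^sub>R w) \<bullet> w - g (x + 0 *\<^sub>R v + b *\<^sub>R w) \<bullet> w
      = t * (H (x + a *\<^sub>R v + b *\<^sub>R w) v \<bullet> w)" by auto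
  show ?thesis
  proof (rule that[of "x + a *\<^sub>R v + b *\<^sub>R w"])
    show "norm (x + a *\<^sub>R v + b *\<^sub>R w - x) \<le> t * (norm v + norm w)"
      using nrm[of a b] a b by simp
    show "f (x + t *\<^sub>R v + t *\<^sub>R w) - f (x + t *\<^sub>R v) - f (x + t *\<^sub>R w) + f x
        = t\<^sup>2 * (H (x + a *\<^sub>R v + b *\<^sub>R w) v \<bullet> w)"
      using eq1 unfolding eq2 \<phi>_def by (simp add: power2_eq_square)
  qed
qed

text \<open>Schwarz's theorem: the mixed second difference does not change when \<open>v\<close> and
  \<open>w\<close> are exchanged, and the two intermediate points both tend to
  \<open>x\<close>.\<close>

lemma C2_data_symmetric:
  fixes f :: "real^'n \<Rightarrow> real"
  assumes C: "C2_data S f g H" and S: "open S" "x \<in> S"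
  shows "H x v \<bullet> w = v \<bullet> H x w"
proof -
  obtain e where e: "e > 0" "ball x e \<subseteq> S" using S openE by blast
  define l where "l = norm v + norm w"
  have l: "l \<ge> 0" by (simp add: l_def)
  define t where "t k = e / (l + 1) / real (k + 2)" for k
  have t: "t k > 0" "t k * l < e" for k
  proof -
    show "t k > 0" using e l by (simp add: t_def)
    have "e * l < e * ((l + 1) * real (k + 2))"
    proof (rule mult_strict_left_mono)
      have "(l + 1) * 1 \<le> (l + 1) * real (k + 2)" using l by (intro mult_left_mono) auto
      then show "l < (l + 1) * real (k + 2)" by simp
    qed (rule e)
    moreover have "(l + 1) * real (k + 2) > 0" using l by simp
    ultimately show "t k * l < e" using l by (simp add: t_def divide_simps)
  qed
  have t0: "t \<longlonglongrightarrow> 0" unfolding t_def 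
    by (rule LIMSEQ_ignore_initial_segment[OF lim_const_over_n])
  have "\<forall>k. \<exists>y. norm (y - x) \<le> t k * l \<and>
     f (x + t k *\<^sub>R v + t k *\<^sub>R w) - f (x + t k *\<^sub>R v) - f (x + t k *\<^sub>R w) + f x = (t k)\<^sup>2 * (H y v \<bullet> w)"
    by (rule allI, rule C2_second_difference[OF C e(2) t(1) t(2)[unfolded l_def]]) (auto simp: l_def)
  then obtain p where p: "\<And>k. norm (p k - x) \<le> t k * l"
    "\<And>k. f (x + t k *\<^sub>R v + t k *\<^sub>R w) - f (x + t k *\<^sub>R v) - f (x + t k *\<^sub>R w) + f x = (t k)\<^sup>2 * (H (p k) v \<bullet> w)"
    by metis
  have "\<forall>k. \<exists>y. norm (y - x) \<le> t k * l \<and>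
     f (x + t k *\<^sub>R w + t k *\<^sub>R v) - f (x + t k *\<^sub>R w) - f (x + t k *\<^sub>R v) + f x = (t k)\<^sup>2 * (H y w \<bullet> v)"
    by (rule allI, rule C2_second_difference[OF C e(2) t(1), where v = w and w = v])
      (use t(2) in \<open>auto simp: l_def add.commute\<close>)
  then obtain p' where p': "\<And>k. norm (p' k - x) \<le> t k * l"
    "\<And>k. f (x + t k *\<^sub>R w + t k *\<^sub>R v) - f (x + t k *\<^sub>R w) - f (x + t k *\<^sub>R v) + f x = (t k)\<^sup>2 * (H (p' k) w \<bullet> v)"
    by metis
  have eq: "H (p k) v \<bullet> w = H (p' k) w \<bullet> v" for k
  proof -
    have "(t k)\<^sup>2 * (H (p k) v \<bullet> w) = (t k)\<^sup>2 * (H (p' k) w \<bullet> v)"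
      unfolding p(2)[symmetric] p'(2)[symmetric] by (simp add: algebra_simps)
    then show ?thesis using t(1)[of k] by simp
  qed
  have tl: "(\<lambda>k. t k * l) \<longlonglongrightarrow> 0" using tendsto_mult_right[OF t0, of l] by simp
  have "(\<lambda>k. p k - x) \<longlonglongrightarrow> 0" "(\<lambda>k. p' k - x) \<longlonglongrightarrow> 0"
    using p(1) p'(1) by (auto intro!: Lim_null_comparison[OF _ tl])
  then have "p \<longlonglongrightarrow> x" "p' \<longlonglongrightarrow> x" by (auto simp: LIM_zero_iff)
  then have "(\<lambda>k. H (p k) v \<bullet> w) \<longlonglongrightarrow> H x v \<bullet> w" "(\<lambda>k. H (p' k) w \<bullet> v) \<longlonglongrightarrow> H x w \<bullet> v"
    by (simp_all add: tendsto_inner C2_data_tendsto[OF C S])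
  then have "H x v \<bullet> w = H x w \<bullet> v" unfolding eq by (rule LIMSEQ_unique)
  then show ?thesis by (simp add: inner_commute)
qed


subsection \<open>Comparison with cones\<close>

lemma inf_visc_subD:
  assumes "inf_visc_sub U u" "x \<in> U" "open S" "x \<in> S" "S \<subseteq> U" "C2_data S \<phi> g H"
    "\<And>y. y \<in> S \<Longrightarrow> u y - \<phi> y \<le> u x - \<phi> x"
  shows "0 \<le> inf_lap g H x"
  using assms(1)[unfolded inf_visc_sub_def, rule_format, of x S \<phi> g H] assms(2-) by simp

lemma inf_visc_sub_subset:
  assumes "inf_visc_sub U u" "V \<subseteq> U"
  shows "inf_visc_sub V u"
  unfolding inf_visc_sub_def
proof (intro ballI allI impI)
  fix x S \<phi> g H
  assume "x \<in> V"
    and "open S \<and> x \<in> S \<and> S \<subseteq> V \<and> C2_data S \<phi> g H \<and> (\<forall>y\<in>S. u y - \<phi> y \<le> u x - \<phi> x)"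
  then show "0 \<le> inf_lap g H x"
    using assms(2) by (intro inf_visc_subD[OF assms(1), of x S \<phi>]) auto
qed

lemma inf_visc_sub_uminus:
  assumes "inf_visc_super U u"
  shows "inf_visc_sub U (\<lambda>x. - u x)"
  unfolding inf_visc_sub_def
proof (intro ballI allI impI)
  fix x S \<phi> g H
  assume x: "x \<in> U"
    and *: "open S \<and> x \<in> S \<and> S \<subseteq> U \<and> C2_data S \<phi> g H \<and> (\<forall>y\<in>S. - u y - \<phi> y \<le> - u x - \<phi> x)"
  have "\<forall>y\<in>S. u y - - \<phi> y \<ge> u x - - \<phi> x" using * by auto
  then have "inf_lap (\<lambda>x. - g x) (\<lambda>x h. - H x h) x \<le> 0"
    using assms[unfolded inf_visc_super_def, rule_format, of x S "\<lambda>x. - \<phi> x"] x * C2_data_minus[of S \<phi> g H]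
    by simp
  moreover have "H x (- g x) = - H x (g x)"
    using * by (intro linear_neg bounded_linear.linear C2_data_linear) auto
  ultimately show "inf_lap g H x \<ge> 0" by (simp add: inf_lap_def)
qed

text \<open>Subtracting a small multiple of \<open>|x - z|\<^sup>2\<close> turns a cone into a strict supersolution.\<close>

lemma cone_comparison:
  fixes u :: "real^'n \<Rightarrow> real"
  assumes U: "open U" "bounded U" and cont: "continuous_on (closure U) u" and sub: "inf_visc_sub U u"
    and z: "z \<notin> U" and bd: "\<And>x. x \<in> frontier U \<Longrightarrow> u x \<le> k + A * norm (x - z)" and x1: "x1 \<in> U"
  shows "u x1 \<le> k + A * norm (x1 - z)"
proof (rule ccontr)
  define d where "d = u x1 - (k + A * norm (x1 - z))"
  assume "\<not> ?thesis"
  then have d: "d > 0" by (simp add: d_def)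
  have "bounded ((\<lambda>x. x - z) ` closure U)"
    using U by (intro bounded_translation_minus bounded_closure)
  then obtain D where D: "D > 0" "\<And>x. x \<in> closure U \<Longrightarrow> norm (x - z) \<le> D"
    unfolding bounded_pos by auto
  \<comment> \<open>The first bound keeps the quadratic below the excess \<open>d\<close>, so the
    maximum of \<open>u - \<phi>\<close> cannot lie on the frontier; the second keeps the gradient
    of \<open>\<phi>\<close> from vanishing when \<open>A > 0\<close>.\<close>
  define \<gamma> where "\<gamma> = min (d / (2 * D\<^sup>2)) (if A > 0 then A / (4 * D) else 1)"
  have \<gamma>: "\<gamma> > 0" using d D by (simp add: \<gamma>_def)
  have "\<gamma> \<le> d / (2 * D\<^sup>2)" by (simp add: \<gamma>_def)
  then have \<gamma>d: "\<gamma> * D\<^sup>2 < d" using d D by (simp add: field_simps)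
  have \<gamma>A: "2 * \<gamma> * D < A" if "A > 0"
  proof -
    have "\<gamma> \<le> A / (4 * D)" using that by (simp add: \<gamma>_def)
    then show ?thesis using that D by (simp add: field_simps)
  qed
  define \<phi> where "\<phi> = (\<lambda>x. k + 0 \<bullet> x + A * norm (x - z) + (- \<gamma>) * (norm (x - z))\<^sup>2)"
  have "compact (closure U)" using U by (simp add: compact_closure)
  moreover have "closure U \<noteq> {}" using x1 by auto
  moreover have "continuous_on (closure U) (\<lambda>x. u x - \<phi> x)"
    unfolding \<phi>_def by (intro continuous_intros cont)
  ultimately obtain p where p: "p \<in> closure U" "\<And>y. y \<in> closure U \<Longrightarrow> u y - \<phi> y \<le> u p - \<phi> p"
    using continuous_attains_sup[of "closure U" "\<lambda>x. u x - \<phi> x"] by blast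
  have le: "\<gamma> * (norm (y - z))\<^sup>2 < d" if "y \<in> closure U" for y
  proof -
    have "(norm (y - z))\<^sup>2 \<le> D\<^sup>2" using D(2)[OF that] by (intro power_mono) auto
    then show ?thesis using \<gamma> \<gamma>d using mult_left_mono[of "(norm (y - z))\<^sup>2" "D\<^sup>2" \<gamma>] by linarith
  qed
  have "u x1 - \<phi> x1 \<ge> d" using \<gamma> by (simp add: \<phi>_def d_def)
  moreover have "u y - \<phi> y < d" if "y \<in> frontier U" for y
    using bd[OF that] le[of y] that by (simp add: \<phi>_def frontier_def)
  moreover have "x1 \<in> closure U" using x1 closure_subset by (rule subsetD[rotated])
  ultimately have "p \<notin> frontier U" using p(2)[of x1] by force
  then have pU: "p \<in> U" using p U by (simp add: frontier_def interior_open)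
  then have pz: "p \<noteq> z" using z by auto
  define n where "n = norm (p - z)"
  have n: "0 < n" "n \<le> D" using pz D p by (auto simp: n_def)
  \<comment> \<open>The gradient of \<open>\<phi>\<close> at \<open>p\<close> is \<open>c\<close>
    times \<open>p - z\<close>. It is radial, so the cone contributes nothing and only the quadratic
    with its negative sign survives, provided \<open>c\<close> is nonzero.\<close>
  define c where "c = A / n - 2 * \<gamma>"
  have c: "c \<noteq> 0"
  proof (cases "A > 0")
    case True
    have "2 * \<gamma> * n \<le> 2 * \<gamma> * D" using n \<gamma> by simp
    with \<gamma>A[OF True] have "2 * \<gamma> * n < A" by linarith
    then show ?thesis using n by (simp add: c_def field_simps)
  next
    case False
    then have "A / n \<le> 0" using n by (simp add: divide_nonpos_pos)
    then show ?thesis using \<gamma> by (simp add: c_def)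
  qed
  have "C2_data U \<phi>
     (\<lambda>x. 0 + (A / norm (x - z)) *\<^sub>R (x - z) + (2 * (- \<gamma>)) *\<^sub>R (x - z))
     (\<lambda>x h. (A / norm (x - z)) *\<^sub>R h - (A * ((x - z) \<bullet> h) / norm (x - z) ^ 3) *\<^sub>R (x - z)
        + (2 * (- \<gamma>)) *\<^sub>R h)"
    unfolding \<phi>_def by (rule C2_data_subset[OF C2_data_cone]) (use z in auto)
  from inf_visc_subD[OF sub pU U(1) pU subset_refl this p(2)[OF subsetD[OF closure_subset]]]
  have "inf_lap (\<lambda>x. 0 + (A / norm (x - z)) *\<^sub>R (x - z) + (2 * (- \<gamma>)) *\<^sub>R (x - z))
     (\<lambda>x h. (A / norm (x - z)) *\<^sub>R h - (A * ((x - z) \<bullet> h) / norm (x - z) ^ 3) *\<^sub>R (x - z)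
        + (2 * (- \<gamma>)) *\<^sub>R h) p \<ge> 0"
    by simp
  then have ge: "A / n * (w \<bullet> w) - A * ((p - z) \<bullet> w)\<^sup>2 / n ^ 3 + 2 * (- \<gamma>) * (w \<bullet> w) \<ge> 0"
    if "w = 0 + (A / n) *\<^sub>R (p - z) + (2 * (- \<gamma>)) *\<^sub>R (p - z)" for w
    unfolding inf_lap_def inf_lap_cone n_def that .
  have nn: "(p - z) \<bullet> (p - z) = n\<^sup>2" by (simp add: n_def power2_norm_eq_inner)
  have "A / n * (c * (c * n\<^sup>2)) - A * (c * n\<^sup>2)\<^sup>2 / n ^ 3 + 2 * (- \<gamma>) * (c * (c * n\<^sup>2)) \<ge> 0"
    using ge[of "c *\<^sub>R (p - z)"] unfolding inner_scaleR_left inner_scaleR_right nn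
    by (simp add: c_def scaleR_left_diff_distrib)
  moreover have "A / n * (c * (c * n\<^sup>2)) = A * (c * n\<^sup>2)\<^sup>2 / n ^ 3"
    using n(1) by (simp add: power2_eq_square power3_eq_cube)
  ultimately have "\<gamma> * (c * n)\<^sup>2 \<le> 0" by (simp add: power2_eq_square mult_ac)
  moreover have "\<gamma> * (c * n)\<^sup>2 > 0" using \<gamma> c n by simp
  ultimately show False by linarith
qed

section \<open>Cone estimates for the potential and rigidity of the ball\<close>

locale inf_potential =
  fixes \<Omega>0 :: "(real^'n) set" and x0 :: "real^'n" and u :: "real^'n \<Rightarrow> real"
  assumes opn: "open \<Omega>0" and bnd: "bounded \<Omega>0" and x0: "x0 \<in> \<Omega>0"
    and pot: "inf_harmonic_potential \<Omega>0 x0 u"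
begin

lemma cont: "continuous_on (closure \<Omega>0) u"
  and u_frontier: "y \<in> frontier \<Omega>0 \<Longrightarrow> u y = 0"
  and u_x0: "u x0 = 1"
  and sub: "inf_visc_sub (\<Omega>0 - {x0}) u"
  and super: "inf_visc_super (\<Omega>0 - {x0}) u"
  using pot by (auto simp: inf_harmonic_potential_def inf_harmonic_visc_def)

lemma isCont_u: "x \<in> \<Omega>0 \<Longrightarrow> isCont u x"
  using cont opn by (meson closure_subset continuous_on_eq_continuous_at continuous_on_subset)

lemma frontier_removed:
  assumes "finite F"
  shows "frontier (\<Omega>0 - F) \<subseteq> frontier \<Omega>0 \<union> F"
proof
  fix x assume x: "x \<in> frontier (\<Omega>0 - F)"
  have o: "open (\<Omega>0 - F)" using assms opn by (simp add: finite_imp_closed open_Diff)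
  have "x \<in> closure \<Omega>0" using x closure_mono[of "\<Omega>0 - F" \<Omega>0] by (auto simp: frontier_def)
  moreover have "x \<notin> \<Omega>0 - F" using x o by (simp add: frontier_def interior_open)
  ultimately show "x \<in> frontier \<Omega>0 \<union> F" using opn by (auto simp: frontier_def interior_open)
qed

text \<open>\<open>F\<close> holds the pole and, if wanted, an interior vertex. Removing these
  points makes the vertex admissible for the comparison and turns them into boundary points, where
  the bound is assumed.\<close>

lemma cone_above:
  assumes F: "finite F" "x0 \<in> F" and z: "z \<notin> \<Omega>0 - F"
    and bd: "\<And>y. y \<in> frontier \<Omega>0 \<Longrightarrow> 0 \<le> k + A * norm (y - z)"
    and pt: "\<And>y. y \<in> F \<Longrightarrow> u y \<le> k + A * norm (y - z)" and x: "x \<in> \<Omega>0"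
  shows "u x \<le> k + A * norm (x - z)"
proof (cases "x \<in> F")
  case False
  show ?thesis
  proof (rule cone_comparison[where U = "\<Omega>0 - F"])
    show "open (\<Omega>0 - F)" using F opn by (simp add: finite_imp_closed open_Diff)
    show "bounded (\<Omega>0 - F)" using bnd by (rule bounded_diff)
    show "continuous_on (closure (\<Omega>0 - F)) u"
      using cont by (rule continuous_on_subset) (simp add: closure_mono)
    show "inf_visc_sub (\<Omega>0 - F) u" using sub F by (auto intro: inf_visc_sub_subset)
    show "u y \<le> k + A * norm (y - z)" if "y \<in> frontier (\<Omega>0 - F)" for y
      using frontier_removed[OF F(1)] that bd pt u_frontier by fastforce
  qed (use z x False in auto)
qed (rule pt)

lemma cone_below:
  assumes F: "finite F" "x0 \<in> F" and z: "z \<notin> \<Omega>0 - F"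
    and bd: "\<And>y. y \<in> frontier \<Omega>0 \<Longrightarrow> k + A * norm (y - z) \<le> 0"
    and pt: "\<And>y. y \<in> F \<Longrightarrow> k + A * norm (y - z) \<le> u y" and x: "x \<in> \<Omega>0"
  shows "k + A * norm (x - z) \<le> u x"
proof (cases "x \<in> F")
  case False
  have "- u x \<le> - k + (- A) * norm (x - z)"
  proof (rule cone_comparison[where U = "\<Omega>0 - F"])
    show "open (\<Omega>0 - F)" using F opn by (simp add: finite_imp_closed open_Diff)
    show "bounded (\<Omega>0 - F)" using bnd by (rule bounded_diff)
    show "continuous_on (closure (\<Omega>0 - F)) (\<lambda>x. - u x)"
      using cont by (intro continuous_on_minus continuous_on_subset[OF cont]) (simp add: closure_mono)
    show "inf_visc_sub (\<Omega>0 - F) (\<lambda>x. - u x)"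
      using inf_visc_sub_uminus[OF super] F by (auto intro: inf_visc_sub_subset)
    show "- u y \<le> - k + (- A) * norm (y - z)" if "y \<in> frontier (\<Omega>0 - F)" for y
      using frontier_removed[OF F(1)] that bd[of y] pt[of y] u_frontier[of y] by fastforce
  qed (use z x False in auto)
  then show ?thesis by simp
qed (rule pt)

definition r where "r = infdist x0 (frontier \<Omega>0)"

lemma frontier_nonempty: "frontier \<Omega>0 \<noteq> {}"
proof
  assume "frontier \<Omega>0 = {}"
  then have "\<Omega>0 = UNIV" using x0 frontier_eq_empty[of \<Omega>0] by blast
  then show False using bnd not_bounded_UNIV by simp
qed

lemma x0_notin_frontier: "x0 \<notin> frontier \<Omega>0"
  using x0 opn by (simp add: frontier_def interior_open)

lemma r_pos: "r > 0"
  unfolding r_def using infdist_pos_not_in_closed[OF frontier_closed frontier_nonempty x0_notin_frontier] .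

lemma r_le: "y \<in> frontier \<Omega>0 \<Longrightarrow> r \<le> norm (y - x0)"
  unfolding r_def using infdist_le[of y "frontier \<Omega>0" x0] by (simp add: dist_norm norm_minus_commute)

lemma nearest_frontier_point: obtains y0 where "y0 \<in> frontier \<Omega>0" "norm (y0 - x0) = r"
proof -
  obtain y where "y \<in> frontier \<Omega>0" "infdist x0 (frontier \<Omega>0) = dist x0 y"
    using infdist_attains_inf[OF frontier_closed frontier_nonempty] by blast
  then show ?thesis using that by (simp add: r_def dist_norm norm_minus_commute)
qed

lemma ball_r_subset: "ball x0 r \<subseteq> \<Omega>0"
proof (rule ccontr)
  assume "\<not> ?thesis"
  then have "ball x0 r \<inter> frontier \<Omega>0 \<noteq> {}"
  proof (intro connected_Int_frontier)
    show "ball x0 r \<inter> \<Omega>0 \<noteq> {}" using x0 r_pos centre_in_ball[of x0 r] by blast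
  qed auto
  then obtain y where "y \<in> frontier \<Omega>0" "norm (y - x0) < r" by (auto simp: dist_norm norm_minus_commute)
  then show False using r_le[of y] by simp
qed

lemma upper_cone:
  assumes "R > 0" "\<And>y. y \<in> frontier \<Omega>0 \<Longrightarrow> norm (y - x0) \<le> R" "x \<in> \<Omega>0"
  shows "u x \<le> 1 - norm (x - x0) / R"
  using cone_above[of "{x0}" x0 1 "- (1 / R)" x] assms u_x0 by simp

lemma lower_cone:
  assumes "x \<in> \<Omega>0"
  shows "1 - norm (x - x0) / r \<le> u x"
  using cone_below[of "{x0}" x0 1 "- (1 / r)" x] assms u_x0 r_le r_pos by simp

lemma u_nonneg: "x \<in> \<Omega>0 \<Longrightarrow> 0 \<le> u x"
  using cone_below[of "{x0}" x0 0 0 x] u_x0 by simp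

lemma outer_radius: obtains R where "R > 0" "\<And>y. y \<in> frontier \<Omega>0 \<Longrightarrow> norm (y - x0) \<le> R"
proof -
  have "bounded (frontier \<Omega>0)"
    by (rule bounded_subset[OF bounded_closure[OF bnd]]) (auto simp: frontier_def)
  then obtain R where R: "\<And>y. y \<in> frontier \<Omega>0 \<Longrightarrow> dist x0 y \<le> R"
    unfolding bounded_any_center[of _ x0] by blast
  have "norm (y - x0) \<le> max R 1" if "y \<in> frontier \<Omega>0" for y
    using R[OF that] by (simp add: dist_norm norm_minus_commute)
  then show ?thesis using that[of "max R 1"] by simp
qed

lemma u_less_one: "x \<in> \<Omega>0 \<Longrightarrow> x \<noteq> x0 \<Longrightarrow> u x < 1"
proof -
  assume x: "x \<in> \<Omega>0" "x \<noteq> x0"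
  obtain R where "R > 0" "\<And>y. y \<in> frontier \<Omega>0 \<Longrightarrow> norm (y - x0) \<le> R" using outer_radius by blast
  then have "u x \<le> 1 - norm (x - x0) / R" "norm (x - x0) / R > 0"
    using upper_cone[of R x] x by simp_all
  then show ?thesis by linarith
qed

lemma u_le_one: "x \<in> \<Omega>0 \<Longrightarrow> u x \<le> 1"
  using u_less_one[of x] u_x0 by fastforce

text \<open>The vertex is the boundary point. As the pole is at distance at least \<open>r\<close>
  from it, the slope \<open>1 / r\<close> lifts the cone to at least 1 there.\<close>

lemma boundary_cone:
  assumes "y \<in> frontier \<Omega>0" "x \<in> \<Omega>0"
  shows "u x \<le> norm (x - y) / r"
proof -
  have "y \<notin> \<Omega>0" using assms opn by (simp add: frontier_def interior_open)
  then show ?thesis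
    using cone_above[of "{x0}" y 0 "1 / r" x] assms u_x0 r_le[OF assms(1)] r_pos
    by (simp add: norm_minus_commute)
qed

text \<open>The downward cone from \<open>x\<close> is nonpositive on the boundary by
  \<open>boundary_cone\<close>, and at the pole it is at most \<open>u x\<close>, hence at most
  1.\<close>

lemma lipschitz:
  assumes x: "x \<in> \<Omega>0" and y: "y \<in> \<Omega>0"
  shows "u x - norm (y - x) / r \<le> u y"
proof -
  have "u x + - (1 / r) * norm (y - x) \<le> u y"
  proof (rule cone_below[of "{x0, x}"])
    show "u x + - (1 / r) * norm (z - x) \<le> 0" if "z \<in> frontier \<Omega>0" for z
      using boundary_cone[OF that x] by (simp add: norm_minus_commute)
    show "u x + - (1 / r) * norm (z - x) \<le> u z" if "z \<in> {x0, x}" for z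
    proof (cases "z = x")
      case False
      have "0 \<le> norm (z - x) / r" using r_pos by simp
      then show ?thesis using False that u_le_one[OF x] u_x0 by auto
    qed simp
  qed (use y in auto)
  then show ?thesis by simp
qed

text \<open>The upward cone from \<open>x\<close> is normalised to reach the value 1 at the pole. It
  touches \<open>u\<close> at \<open>x\<close>, so its slope will bound |Du| there.\<close>

lemma slope_bound:
  assumes x: "x \<in> \<Omega>0" "x \<noteq> x0" and y: "y \<in> \<Omega>0"
  shows "u y \<le> u x + (1 - u x) / norm (x - x0) * norm (y - x)"
proof -
  have s: "(1 - u x) / norm (x - x0) \<ge> 0" using u_le_one[OF x(1)] by simp
  show ?thesis
  proof (rule cone_above[of "{x0, x}"])
    show "0 \<le> u x + (1 - u x) / norm (x - x0) * norm (z - x)" for z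
      using u_nonneg[OF x(1)] s by (intro add_nonneg_nonneg mult_nonneg_nonneg) auto
    show "u z \<le> u x + (1 - u x) / norm (x - x0) * norm (z - x)" if "z \<in> {x0, x}" for z
      using that x u_x0 by (auto simp: norm_minus_commute[of x0])
  qed (use y in auto)
qed

text \<open>The cone from the nearest boundary point bounds \<open>u\<close> from above, the cone
  from the pole bounds it from below, and on the segment joining the two vertices both have the same
  values.\<close>

lemma steepest_segment:
  obtains v where "norm v = 1" "\<And>t. 0 \<le> t \<Longrightarrow> t < r \<Longrightarrow> x0 + t *\<^sub>R v \<in> \<Omega>0"
    "\<And>t. 0 \<le> t \<Longrightarrow> t < r \<Longrightarrow> u (x0 + t *\<^sub>R v) = 1 - t / r"
proof -
  obtain y0 where y0: "y0 \<in> frontier \<Omega>0" "norm (y0 - x0) = r" using nearest_frontier_point .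
  define v where "v = (1 / r) *\<^sub>R (y0 - x0)"
  have v: "norm v = 1" using y0 r_pos by (simp add: v_def)
  have in\<Omega>: "x0 + t *\<^sub>R v \<in> \<Omega>0" if "0 \<le> t" "t < r" for t
    using that v by (intro subsetD[OF ball_r_subset]) (simp add: dist_norm)
  have "u (x0 + t *\<^sub>R v) = 1 - t / r" if t: "0 \<le> t" "t < r" for t
  proof (rule antisym)
    have "y0 = x0 + r *\<^sub>R v" using r_pos by (simp add: v_def)
    then have "x0 + t *\<^sub>R v - y0 = (t - r) *\<^sub>R v" by (simp add: algebra_simps)
    then have "norm (x0 + t *\<^sub>R v - y0) = r - t" using v t by simp
    then show "u (x0 + t *\<^sub>R v) \<le> 1 - t / r"
      using boundary_cone[OF y0(1) in\<Omega>[OF t]] r_pos by (simp add: diff_divide_distrib)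
    show "1 - t / r \<le> u (x0 + t *\<^sub>R v)" using lower_cone[OF in\<Omega>[OF t]] v t by simp
  qed
  with v in\<Omega> that show ?thesis by blast
qed

text \<open>Because \<open>u\<close> is nonnegative, the assumption bounds |x - x0| by
  \<open>r\<close>; openness then removes the sphere.\<close>

lemma ball_rigidity:
  assumes "\<And>x. x \<in> \<Omega>0 \<Longrightarrow> x \<noteq> x0 \<Longrightarrow> norm (x - x0) / r \<le> 1 - u x"
  shows "\<Omega>0 = ball x0 r"
proof
  have "\<Omega>0 \<subseteq> cball x0 r"
  proof
    fix x assume x: "x \<in> \<Omega>0"
    show "x \<in> cball x0 r"
    proof (cases "x = x0")
      case False
      then have "norm (x - x0) / r \<le> 1" using assms[OF x] u_nonneg[OF x] by simp
      then show ?thesis using r_pos by (simp add: dist_norm norm_minus_commute)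
    qed (use r_pos in auto)
  qed
  then have "interior \<Omega>0 \<subseteq> interior (cball x0 r)" by (rule interior_mono)
  then show "\<Omega>0 \<subseteq> ball x0 r" using opn by (simp add: interior_open)
qed (rule ball_r_subset)

text \<open>All boundary points of a ball have the same distance from the centre, so the upper and
  the lower cone coincide.\<close>

lemma ball_potential:
  assumes "\<rho> > 0" "\<Omega>0 = ball x0 \<rho>" "x \<in> \<Omega>0"
  shows "u x = 1 - norm (x - x0) / \<rho>"
proof -
  have "frontier \<Omega>0 = sphere x0 \<rho>" using assms(1) unfolding assms(2) by (rule frontier_ball)
  then have fr: "norm (y - x0) = \<rho>" if "y \<in> frontier \<Omega>0" for y
    using that by (simp add: dist_norm norm_minus_commute[of x0])
  obtain y0 where y0: "y0 \<in> frontier \<Omega>0" "norm (y0 - x0) = r" using nearest_frontier_point .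
  have r: "r = \<rho>" using fr[OF y0(1)] y0(2) by simp
  show ?thesis
  proof (rule antisym)
    show "u x \<le> 1 - norm (x - x0) / \<rho>" by (rule upper_cone[OF assms(1) eq_refl[OF fr] assms(3)])
    show "1 - norm (x - x0) / \<rho> \<le> u x" using lower_cone[OF assms(3)] unfolding r .
  qed
qed

end


subsection \<open>Asymptotics at the pole\<close>

text \<open>\<open>L\<close> is the limit superior along \<open>F\<close>, delivered through the two
  properties that are used later.\<close>

lemma bounded_Limsup_real:
  fixes f :: "'a \<Rightarrow> real"
  assumes F: "F \<noteq> bot" and B: "eventually (\<lambda>x. \<bar>f x\<bar> \<le> B) F"
  obtains L where "\<And>\<epsilon>. \<epsilon> > 0 \<Longrightarrow> eventually (\<lambda>x. f x \<le> L + \<epsilon>) F"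
    "\<And>\<epsilon>. \<epsilon> > 0 \<Longrightarrow> frequently (\<lambda>x. f x \<ge> L - \<epsilon>) F"
proof -
  define M where "M = {l. eventually (\<lambda>x. f x \<le> l) F}"
  have "B \<in> M" using B by (auto simp: M_def elim: eventually_mono)
  have "- B \<le> l" if "l \<in> M" for l
  proof -
    have "eventually (\<lambda>x. f x \<le> l \<and> \<bar>f x\<bar> \<le> B) F"
      using that B unfolding M_def by (auto intro: eventually_conj)
    then obtain x where "f x \<le> l \<and> \<bar>f x\<bar> \<le> B" using eventually_happens'[OF F] by blast
    then show ?thesis by linarith
  qed
  then have bdd: "bdd_below M" by (auto simp: bdd_below_def)
  show ?thesis
  proof (rule that[of "Inf M"])
    fix \<epsilon> :: real assume \<epsilon>: "\<epsilon> > 0"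
    have "Inf M < Inf M + \<epsilon>" using \<epsilon> by simp
    then obtain l where "l \<in> M" "l < Inf M + \<epsilon>" using \<open>B \<in> M\<close> cInf_lessD[of M "Inf M + \<epsilon>"] by auto
    then show "eventually (\<lambda>x. f x \<le> Inf M + \<epsilon>) F"
      unfolding M_def by (auto elim: eventually_mono)
    show "frequently (\<lambda>x. f x \<ge> Inf M - \<epsilon>) F"
      unfolding frequently_def
    proof
      assume "eventually (\<lambda>x. \<not> Inf M - \<epsilon> \<le> f x) F"
      then have "Inf M - \<epsilon> \<in> M" unfolding M_def by (auto elim: eventually_mono)
      then show False using cInf_lower[OF _ bdd] \<epsilon> by fastforce
    qed
  qed
qed

lemma frequently_eventually_ex:
  assumes "frequently P F" "eventually Q F"
  shows "\<exists>x. P x \<and> Q x"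
  using frequently_ex[OF frequently_eventually_frequently[OF assms]] by blast

text \<open>Projecting orthogonally to \<open>y\<close> removes the cone term. The tilt keeps a
  tangential part of squared length \<beta>^2 (1 - \<kappa>^2), where \<kappa> is the cosine of its
  angle with \<open>y\<close>, and the perturbation \<open>w\<close> enters mainly through a cross
  term of size at most 4 \<beta> \<mu>.\<close>

lemma transversal_gradient_bound:
  fixes y c w :: "real^'n"
  assumes y: "y \<noteq> 0" and c: "norm c = 1" and cy: "\<bar>c \<bullet> y\<bar> \<le> (1 - \<omega>) * norm y" and \<omega>: "0 < \<omega>" "\<omega> \<le> 1"
    and \<beta>: "\<beta> > 0" and w: "norm w \<le> \<mu>" and v: "v = - (\<beta> *\<^sub>R c) + (- A / norm y) *\<^sub>R y + w"
  shows "\<beta>\<^sup>2 * \<omega> - 4 * \<beta> * \<mu> \<le> v \<bullet> v - (y \<bullet> v)\<^sup>2 / (norm y)\<^sup>2"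
proof -
  define e where "e = (1 / norm y) *\<^sub>R y"
  have ee: "e \<bullet> e = 1" and ne: "norm e = 1" using y by (auto simp: e_def dot_square_norm power2_eq_square)
  have cc: "c \<bullet> c = 1" using c by (simp add: dot_square_norm)
  define \<kappa> p q where "\<kappa> = c \<bullet> e" and "p = c \<bullet> w" and "q = e \<bullet> w"
  have v': "v = - (\<beta> *\<^sub>R c) - A *\<^sub>R e + w" by (simp add: v e_def)
  have ev: "(y \<bullet> v)\<^sup>2 / (norm y)\<^sup>2 = (e \<bullet> v)\<^sup>2" by (simp add: e_def power_divide)
  have vv: "v \<bullet> v = \<beta>\<^sup>2 + A\<^sup>2 + w \<bullet> w + 2 * \<beta> * A * \<kappa> - 2 * \<beta> * p - 2 * A * q"
    unfolding v' \<kappa>_def p_def q_def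
    by (simp add: inner_add_left inner_add_right inner_diff_left inner_diff_right cc ee inner_commute
        power2_eq_square algebra_simps)
  have ev': "e \<bullet> v = - \<beta> * \<kappa> - A + q"
    unfolding v' \<kappa>_def q_def by (simp add: inner_add_right inner_diff_right ee inner_commute)
  have "v \<bullet> v - (e \<bullet> v)\<^sup>2 = \<beta>\<^sup>2 * (1 - \<kappa>\<^sup>2) + (w \<bullet> w - q\<^sup>2) - 2 * \<beta> * (p - \<kappa> * q)"
    unfolding vv ev' by (simp add: power2_eq_square algebra_simps)
  moreover have "\<beta>\<^sup>2 * (1 - \<kappa>\<^sup>2) \<ge> \<beta>\<^sup>2 * \<omega>"
  proof (rule mult_left_mono)
    have "\<bar>\<kappa>\<bar> \<le> 1 - \<omega>" using cy y by (simp add: \<kappa>_def e_def field_simps)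
    then have "\<kappa>\<^sup>2 \<le> (1 - \<omega>)\<^sup>2" by (rule power2_le_iff_abs_le[THEN iffD2, rotated]) (use \<omega> in auto)
    also have "\<dots> \<le> 1 * (1 - \<omega>)" unfolding power2_eq_square using \<omega> by (intro mult_right_mono) auto
    finally show "\<omega> \<le> 1 - \<kappa>\<^sup>2" by simp
  qed simp
  moreover have q: "\<bar>q\<bar> \<le> norm w" using Cauchy_Schwarz_ineq2[of e w] ne by (simp add: q_def)
  then have "q\<^sup>2 \<le> w \<bullet> w" by (simp add: power2_norm_eq_inner[symmetric] abs_le_square_iff[symmetric])
  moreover have "p - \<kappa> * q \<le> 2 * \<mu>"
  proof -
    have "p \<le> norm w" using Cauchy_Schwarz_ineq2[of c w] c by (simp add: p_def)
    moreover have "\<bar>\<kappa>\<bar> \<le> 1" using Cauchy_Schwarz_ineq2[of c e] c ne by (simp add: \<kappa>_def)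
    then have "\<bar>\<kappa>\<bar> * \<bar>q\<bar> \<le> 1 * norm w" using q by (intro mult_mono) auto
    then have "- (\<kappa> * q) \<le> norm w" by (simp add: abs_mult[symmetric])
    ultimately show ?thesis using w by linarith
  qed
  then have "2 * \<beta> * (p - \<kappa> * q) \<le> 2 * \<beta> * (2 * \<mu>)" using \<beta> by (intro mult_left_mono) auto
  ultimately show ?thesis unfolding ev by (simp add: algebra_simps)
qed

context inf_potential
begin

text \<open>The function \<open>- A |x| - \<beta> c \<cdot> x\<close> is a strict supersolution away from the axis spanned by \<open>c\<close>,
  so \<open>u\<close> cannot touch it asymptotically at \<open>x0\<close> along off-axis directions.\<close>

lemma off_axis_strict:
  fixes c :: "real^'n"
  assumes c: "norm c = 1" and \<beta>: "\<beta> > 0" and A: "A > 0" and \<omega>: "0 < \<omega>" "\<omega> \<le> 1/2"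
    and above: "\<And>\<epsilon>. \<epsilon> > 0 \<Longrightarrow>
      eventually (\<lambda>x. u x - 1 + \<beta> * (c \<bullet> (x - x0)) \<le> (\<epsilon> - A) * norm (x - x0)) (at x0)"
  obtains \<epsilon> where "\<epsilon> > 0" "eventually (\<lambda>x. \<bar>c \<bullet> (x - x0)\<bar> \<le> (1 - 2 * \<omega>) * norm (x - x0) \<longrightarrow>
      u x - 1 + \<beta> * (c \<bullet> (x - x0)) < (- A - \<epsilon>) * norm (x - x0)) (at x0)"
proof -
  \<comment> \<open>With this relative radius, a ball around a point satisfying the off-axis
    condition for \<open>2 * \<omega>\<close> still satisfies it for
    \<open>\<omega>\<close>.\<close>
  define \<delta> where "\<delta> = \<omega> / 2"
  have \<delta>: "\<delta> > 0" "\<delta> \<le> 1/4" using \<omega> by (auto simp: \<delta>_def)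
  define G where "G = A + \<beta> + 1"
  have G: "G > 0" using A \<beta> by (simp add: G_def)
  \<comment> \<open>\<open>\<eta>\<close> scales the quadratic penalty. Its three bounds leave at
    least half of the tangential part of the gradient, keep the total gradient below
    \<open>G\<close>, and make the second derivative of the penalty smaller than the curvature of
    the cone.\<close>
  define \<eta> where "\<eta> = min (min (\<beta> * \<omega> / 16) (1/2)) (A * \<beta>\<^sup>2 * \<omega> / (16 * G\<^sup>2))"
  have \<eta>: "\<eta> > 0" "\<eta> \<le> \<beta> * \<omega> / 16" "\<eta> \<le> 1/2" "\<eta> \<le> A * \<beta>\<^sup>2 * \<omega> / (16 * G\<^sup>2)"
    using A \<beta> \<omega> G by (auto simp: \<eta>_def)
  \<comment> \<open>On the sphere of radius \<delta> t the penalty equals 4 \<epsilon> t. There the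
    excess of \<open>u\<close> over the tilted cone is at most (5/4) \<epsilon> t, while at the
    centre it is at least - \<epsilon> t, so the maximum is interior.\<close>
  define \<epsilon> where "\<epsilon> = \<eta> * \<delta>\<^sup>2 / 4"
  have \<epsilon>: "\<epsilon> > 0" using \<eta> \<delta> by (simp add: \<epsilon>_def)
  obtain \<rho>1 where \<rho>1: "\<rho>1 > 0" "\<And>x. x \<noteq> x0 \<Longrightarrow> norm (x - x0) < \<rho>1 \<Longrightarrow>
      u x - 1 + \<beta> * (c \<bullet> (x - x0)) \<le> (\<epsilon> - A) * norm (x - x0)"
    using above[OF \<epsilon>] unfolding eventually_at by (auto simp: dist_norm)
  define \<rho> where "\<rho> = min \<rho>1 r / 2"
  have \<rho>: "\<rho> > 0" "2 * \<rho> \<le> \<rho>1" "2 * \<rho> \<le> r" using \<rho>1 r_pos by (auto simp: \<rho>_def)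
  have "u p - 1 + \<beta> * (c \<bullet> (p - x0)) < (- A - \<epsilon>) * norm (p - x0)"
    if p: "p \<noteq> x0" "norm (p - x0) < \<rho>" and pc: "\<bar>c \<bullet> (p - x0)\<bar> \<le> (1 - 2 * \<omega>) * norm (p - x0)" for p
  proof (rule ccontr)
    assume neg: "\<not> ?thesis"
    define t where "t = norm (p - x0)"
    have t: "t > 0" "t < \<rho>" using p by (auto simp: t_def)
    have near: "3/4 * t \<le> norm (x - x0)" "norm (x - x0) \<le> 5/4 * t"
      "\<bar>c \<bullet> (x - x0)\<bar> \<le> (1 - \<omega>) * norm (x - x0)" if "norm (x - p) \<le> \<delta> * t" for x
    proof -
      have "\<delta> * t \<le> 1/4 * t" using \<delta> t by (intro mult_right_mono) auto
      moreover have "t \<le> norm (x - x0) + norm (x - p)"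
        using norm_triangle_ineq4[of "x - x0" "x - p"] by (simp add: t_def)
      moreover have "norm (x - x0) \<le> t + norm (x - p)"
        using norm_triangle_ineq[of "p - x0" "x - p"] by (simp add: t_def)
      ultimately show "3/4 * t \<le> norm (x - x0)" "norm (x - x0) \<le> 5/4 * t" using that by linarith+
      have lo: "(1 - \<delta>) * t \<le> norm (x - x0)"
        using \<open>t \<le> norm (x - x0) + norm (x - p)\<close> that by (simp add: algebra_simps)
      have "c \<bullet> (x - x0) = c \<bullet> (p - x0) + c \<bullet> (x - p)" by (simp add: inner_diff_right)
      moreover have "\<bar>c \<bullet> (x - p)\<bar> \<le> \<delta> * t" using Cauchy_Schwarz_ineq2[of c "x - p"] c that by simp
      ultimately have "\<bar>c \<bullet> (x - x0)\<bar> \<le> (1 - 2 * \<omega>) * t + \<delta> * t" using pc[folded t_def] by linarith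
      also have "\<dots> \<le> ((1 - \<omega>) * (1 - \<delta>)) * t"
      proof -
        have "(1 - 2 * \<omega>) + \<delta> \<le> (1 - \<omega>) * (1 - \<delta>)" using \<omega> by (simp add: \<delta>_def algebra_simps)
        then show ?thesis using t by (simp add: mult_right_mono flip: distrib_right)
      qed
      also have "\<dots> \<le> (1 - \<omega>) * norm (x - x0)"
        using lo \<omega> mult_left_mono[OF lo, of "1 - \<omega>"] by (simp add: mult.assoc)
      finally show "\<bar>c \<bullet> (x - x0)\<bar> \<le> (1 - \<omega>) * norm (x - x0)" .
    qed
    define b where "b = - (\<beta> *\<^sub>R c)"
    define k where "k = 1 + \<beta> * (c \<bullet> x0)"
    define \<phi> where "\<phi> = (\<lambda>x. k + b \<bullet> x + (- A) * norm (x - x0) + (\<eta> / t) * (norm (x - p))\<^sup>2)"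
    have \<phi>: "u x - \<phi> x = u x - 1 + \<beta> * (c \<bullet> (x - x0)) + A * norm (x - x0) - (\<eta> / t) * (norm (x - p))\<^sup>2" for x
      by (simp add: \<phi>_def k_def b_def inner_diff_right algebra_simps)
    have sub\<Omega>: "x \<in> \<Omega>0 - {x0}" if "norm (x - p) \<le> \<delta> * t" for x
      using near(1,2)[OF that] t \<rho> r_pos by (auto simp: dist_norm norm_minus_commute intro!: subsetD[OF ball_r_subset])
    have cb: "x \<in> cball p (\<delta> * t) \<longleftrightarrow> norm (x - p) \<le> \<delta> * t" for x
      by (simp add: dist_norm norm_minus_commute)
    have "continuous_on (cball p (\<delta> * t)) u"
      using sub\<Omega> cb isCont_u by (intro continuous_at_imp_continuous_on) blast
    then have "continuous_on (cball p (\<delta> * t)) (\<lambda>x. u x - \<phi> x)"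
      unfolding \<phi>_def by (intro continuous_intros)
    moreover have "p \<in> cball p (\<delta> * t)" using \<delta> t by simp
    ultimately obtain q where q: "q \<in> cball p (\<delta> * t)"
      "\<And>y. y \<in> cball p (\<delta> * t) \<Longrightarrow> u y - \<phi> y \<le> u q - \<phi> q"
      using continuous_attains_sup[of "cball p (\<delta> * t)" "\<lambda>x. u x - \<phi> x"] compact_cball by blast
    have q\<delta>: "norm (q - p) \<le> \<delta> * t" using q(1) cb by blast
    have "norm (q - p) \<noteq> \<delta> * t"
    proof
      assume eq: "norm (q - p) = \<delta> * t"
      have "q \<noteq> x0" using sub\<Omega>[OF q\<delta>] by auto
      then have "u q - 1 + \<beta> * (c \<bullet> (q - x0)) \<le> (\<epsilon> - A) * norm (q - x0)"
        using near(2)[OF q\<delta>] t \<rho> by (intro \<rho>1(2)) auto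
      moreover have "\<epsilon> * norm (q - x0) \<le> \<epsilon> * (5/4 * t)" using near(2)[OF q\<delta>] \<epsilon> by (intro mult_left_mono) auto
      moreover have "(\<eta> / t) * (norm (q - p))\<^sup>2 = 4 * \<epsilon> * t"
        using t unfolding eq by (simp add: \<epsilon>_def power2_eq_square)
      ultimately have "u q - \<phi> q \<le> \<epsilon> * (5/4 * t) - 4 * \<epsilon> * t" unfolding \<phi> by (simp add: algebra_simps)
      moreover have "u p - \<phi> p \<ge> - \<epsilon> * t" using neg unfolding \<phi> by (simp add: t_def algebra_simps)
      moreover have "\<epsilon> * t > 0" using \<epsilon> t by simp
      ultimately show False using q(2)[of p] \<delta> t by simp
    qed
    then have qb: "q \<in> ball p (\<delta> * t)" using q\<delta> by (simp add: dist_norm norm_minus_commute)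
    have bsub: "ball p (\<delta> * t) \<subseteq> \<Omega>0 - {x0}"
      by (rule subsetI, rule sub\<Omega>) (simp add: dist_norm norm_minus_commute)
    define v where "v = b + (- A / norm (q - x0)) *\<^sub>R (q - x0) + (2 * (\<eta> / t)) *\<^sub>R (q - p)"
    have C2: "C2_data (ball p (\<delta> * t)) \<phi>
      (\<lambda>x. b + (- A / norm (x - x0)) *\<^sub>R (x - x0) + (2 * (\<eta> / t)) *\<^sub>R (x - p))
      (\<lambda>x h. (- A / norm (x - x0)) *\<^sub>R h - (- A * ((x - x0) \<bullet> h) / norm (x - x0) ^ 3) *\<^sub>R (x - x0)
        + (2 * (\<eta> / t)) *\<^sub>R h)"
      unfolding \<phi>_def by (rule C2_data_subset[OF C2_data_cone]) (use bsub in blast)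
    have "0 \<le> inf_lap (\<lambda>x. b + (- A / norm (x - x0)) *\<^sub>R (x - x0) + (2 * (\<eta> / t)) *\<^sub>R (x - p))
      (\<lambda>x h. (- A / norm (x - x0)) *\<^sub>R h - (- A * ((x - x0) \<bullet> h) / norm (x - x0) ^ 3) *\<^sub>R (x - x0)
        + (2 * (\<eta> / t)) *\<^sub>R h) q"
      by (rule inf_visc_subD[OF sub sub\<Omega>[OF q\<delta>] open_ball qb bsub C2]) (simp add: q(2))
    then have ge: "0 \<le> - A / norm (q - x0) * (v \<bullet> v) - - A * ((q - x0) \<bullet> v)\<^sup>2 / norm (q - x0) ^ 3
        + 2 * (\<eta> / t) * (v \<bullet> v)"
      unfolding inf_lap_def inf_lap_cone v_def .
    define n where "n = norm (q - x0)"
    have n: "n > 0" "n \<le> 2 * t" using near[OF q\<delta>] t by (auto simp: n_def)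
    define T where "T = v \<bullet> v - ((q - x0) \<bullet> v)\<^sup>2 / n\<^sup>2"
    have nw: "norm ((2 * (\<eta> / t)) *\<^sub>R (q - p)) \<le> 2 * \<eta>"
    proof -
      have "norm ((2 * (\<eta> / t)) *\<^sub>R (q - p)) = 2 * (\<eta> / t) * norm (q - p)" using \<eta> t by simp
      also have "\<dots> \<le> 2 * (\<eta> / t) * (1 * t)"
        using q\<delta> \<delta> t \<eta> by (intro mult_left_mono order_trans[OF q\<delta>] mult_right_mono) auto
      finally show ?thesis using t by simp
    qed
    have "\<beta>\<^sup>2 * \<omega> - 4 * \<beta> * (2 * \<eta>) \<le> T"
      unfolding T_def n_def
    proof (rule transversal_gradient_bound[OF _ c near(3)[OF q\<delta>] \<omega>(1) _ \<beta> nw])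
      show "v = - (\<beta> *\<^sub>R c) + (- A / norm (q - x0)) *\<^sub>R (q - x0) + (2 * (\<eta> / t)) *\<^sub>R (q - p)"
        by (simp add: v_def b_def)
    qed (use n n_def \<omega> in auto)
    moreover have "4 * \<beta> * (2 * \<eta>) \<le> 4 * \<beta> * (2 * (\<beta> * \<omega> / 16))" using \<beta> \<eta>(2) by (intro mult_left_mono) auto
    ultimately have T: "\<beta>\<^sup>2 * \<omega> / 2 \<le> T" by (simp add: power2_eq_square)
    have vv: "v \<bullet> v \<le> G\<^sup>2"
    proof -
      have "norm v \<le> norm b + norm ((- A / norm (q - x0)) *\<^sub>R (q - x0)) + norm ((2 * (\<eta> / t)) *\<^sub>R (q - p))"
        unfolding v_def by (intro order_trans[OF norm_triangle_ineq] add_right_mono norm_triangle_ineq)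
      also have "\<dots> \<le> \<beta> + A + 1"
      proof (intro add_mono)
        show "norm b \<le> \<beta>" using c \<beta> by (simp add: b_def)
        show "norm ((- A / norm (q - x0)) *\<^sub>R (q - x0)) \<le> A" using A n by (simp add: n_def)
        show "norm ((2 * (\<eta> / t)) *\<^sub>R (q - p)) \<le> 1" using nw \<eta>(3) by linarith
      qed
      finally show ?thesis
        by (metis G_def add.commute add.left_commute dot_square_norm norm_ge_zero power_mono)
    qed
    \<comment> \<open>The cone contributes \<open>A / n\<close> times the tangential part
      \<open>T\<close>, with negative sign. As \<open>n\<close> is at most \<open>2 * t\<close>,
      this outweighs the penalty term by the third bound on \<open>\<eta>\<close>.\<close>
    have "- A / n * (v \<bullet> v) - - A * ((q - x0) \<bullet> v)\<^sup>2 / n ^ 3 = - (A / n) * T"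
      using n by (simp add: T_def field_simps power2_eq_square power3_eq_cube)
    then have "A / n * T \<le> 2 * (\<eta> / t) * (v \<bullet> v)" using ge unfolding n_def[symmetric] by simp
    also have "\<dots> \<le> 2 * (\<eta> / t) * G\<^sup>2" using vv \<eta> t by (intro mult_left_mono) auto
    also have "\<dots> \<le> 2 * ((A * \<beta>\<^sup>2 * \<omega> / (16 * G\<^sup>2)) / t) * G\<^sup>2"
      using \<eta>(4) t by (intro mult_left_mono mult_right_mono divide_right_mono) auto
    also have "\<dots> = A / t * (\<beta>\<^sup>2 * \<omega> / 8)" using G by (simp add: field_simps)
    finally have "A / n * T \<le> A / t * (\<beta>\<^sup>2 * \<omega> / 8)" .
    moreover have "A / (2 * t) * (\<beta>\<^sup>2 * \<omega> / 2) \<le> A / n * T"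
      using n T A t \<omega> by (intro mult_mono divide_left_mono) auto
    moreover have "A / t * (\<beta>\<^sup>2 * \<omega>) > 0" using A t \<beta> \<omega> by simp
    ultimately show False by (simp add: field_simps)
  qed
  then have "eventually (\<lambda>x. \<bar>c \<bullet> (x - x0)\<bar> \<le> (1 - 2 * \<omega>) * norm (x - x0) \<longrightarrow>
      u x - 1 + \<beta> * (c \<bullet> (x - x0)) < (- A - \<epsilon>) * norm (x - x0)) (at x0)"
    unfolding eventually_at using \<rho>(1) by (auto simp: dist_norm intro!: exI[of _ \<rho>])
  then show ?thesis using that \<epsilon> by blast
qed

end

text \<open>Dimension at least 2 provides an orthogonal direction towards which \<open>v\<close> is
  turned. The result is a second tilt direction, distinct from \<open>v\<close> but still close to
  the steepest one.\<close>

lemma unit_vector_nearby: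
  fixes v :: "real^'n"
  assumes card: "CARD('n) \<ge> 2" and v: "norm v = 1" and d: "d > 0"
  obtains c where "norm c = 1" "c \<noteq> v" "norm (c - v) \<le> d"
proof -
  obtain w' :: "real^'n" where w': "w' \<noteq> 0" "orthogonal v w'"
    using orthogonal_to_vector_exists[of v] card by auto
  define w where "w = sgn w'"
  have w: "norm w = 1" "v \<bullet> w = 0"
    using w' by (auto simp: w_def norm_sgn sgn_div_norm orthogonal_def)
  define z where "z = v + (d / 2) *\<^sub>R w"
  have zv: "norm (z - v) = d / 2" using w d by (simp add: z_def)
  have wz: "w \<bullet> z = d / 2" using w by (simp add: z_def inner_add_right inner_commute dot_square_norm)
  have z0: "z \<noteq> 0" using wz d by auto
  have "norm (sgn z - z) = \<bar>1 - norm z\<bar>"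
  proof -
    have "norm z *\<^sub>R sgn z = z" using z0 by (simp add: sgn_div_norm)
    then have "sgn z - z = (1 - norm z) *\<^sub>R sgn z" by (simp add: scaleR_left_diff_distrib)
    then show ?thesis using z0 by (simp add: norm_sgn)
  qed
  also have "\<dots> \<le> norm (z - v)" using v norm_triangle_ineq3[of v z] by (simp add: norm_minus_commute)
  finally have "norm (sgn z - z) \<le> d / 2" by (simp add: zv)
  then have "norm (sgn z - v) \<le> d"
    using norm_triangle_ineq[of "sgn z - z" "z - v"] zv by simp
  moreover have "sgn z \<noteq> v"
  proof
    assume "sgn z = v"
    then have "w \<bullet> sgn z = 0" using w by (simp add: inner_commute)
    then show False using wz z0 d by (simp add: sgn_div_norm)
  qed
  moreover have "norm (sgn z) = 1" using z0 by (simp add: norm_sgn)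
  ultimately show ?thesis by (intro that[of "sgn z"])
qed

lemma unit_vectors_dist_sq:
  fixes a b :: "'a::real_inner"
  assumes "norm a = 1" "norm b = 1"
  shows "(norm (a - b))\<^sup>2 = 2 - 2 * (a \<bullet> b)" "(norm (a + b))\<^sup>2 = 2 + 2 * (a \<bullet> b)"
proof -
  have "a \<bullet> a = 1" "b \<bullet> b = 1" using assms by (simp_all add: dot_square_norm)
  then show "(norm (a - b))\<^sup>2 = 2 - 2 * (a \<bullet> b)" "(norm (a + b))\<^sup>2 = 2 + 2 * (a \<bullet> b)"
    by (simp_all add: power2_norm_eq_inner inner_diff_left inner_diff_right inner_add_left
        inner_add_right inner_commute)
qed

context inf_potential
begin

lemma eventually_near: "d > 0 \<Longrightarrow> eventually (\<lambda>x. x \<noteq> x0 \<and> x \<in> \<Omega>0 \<and> norm (x - x0) < d) (at x0)"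
  using r_pos by (auto simp: eventually_at dist_norm norm_minus_commute
      intro!: exI[of _ "min d r"] subsetD[OF ball_r_subset])

definition slope where "slope x = (1 - u x) / norm (x - x0)"

lemma slope_le: "x \<in> \<Omega>0 \<Longrightarrow> x \<noteq> x0 \<Longrightarrow> slope x \<le> 1 / r"
  using lower_cone[of x] r_pos by (simp add: slope_def field_simps)

lemma slope_lower_bound: obtains \<mu> where "\<mu> > 0" "\<And>x. x \<in> \<Omega>0 \<Longrightarrow> x \<noteq> x0 \<Longrightarrow> \<mu> \<le> slope x"
proof -
  obtain R where R: "R > 0" "\<And>y. y \<in> frontier \<Omega>0 \<Longrightarrow> norm (y - x0) \<le> R" using outer_radius by blast
  have "1 / R \<le> slope x" if "x \<in> \<Omega>0" "x \<noteq> x0" for x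
    using upper_cone[OF R that(1)] that R(1) by (simp add: slope_def field_simps)
  then show ?thesis using that[of "1 / R"] R by simp
qed

text \<open>Compare \<open>x\<close> with the point of the steepest segment at the same distance
  from the pole: the Lipschitz constant \<open>1 / r\<close> converts the angular deviation into a
  loss of slope.\<close>

lemma slope_direction:
  assumes v: "norm v = 1" "\<And>t. 0 \<le> t \<Longrightarrow> t < r \<Longrightarrow> x0 + t *\<^sub>R v \<in> \<Omega>0"
      "\<And>t. 0 \<le> t \<Longrightarrow> t < r \<Longrightarrow> u (x0 + t *\<^sub>R v) = 1 - t / r"
    and x: "x \<in> \<Omega>0" "x \<noteq> x0" "norm (x - x0) < r"
  shows "1 / r - norm (sgn (x - x0) - v) / r \<le> slope x"
proof -
  define t where "t = norm (x - x0)"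
  have t: "0 < t" "t < r" using x by (auto simp: t_def)
  have "u x - norm (x0 + t *\<^sub>R v - x) / r \<le> 1 - t / r"
    using lipschitz[OF x(1) v(2)[of t]] v(3)[of t] t by simp
  moreover have "x - x0 = t *\<^sub>R sgn (x - x0)" using t by (simp add: t_def sgn_div_norm)
  then have "x0 + t *\<^sub>R v - x = t *\<^sub>R (v - sgn (x - x0))"
    by (metis add.commute add_diff_eq diff_diff_eq2 scaleR_right_diff_distrib)
  then have "norm (x0 + t *\<^sub>R v - x) = t * norm (sgn (x - x0) - v)"
    using t by (simp add: norm_minus_commute)
  ultimately have "t * (1 / r - norm (sgn (x - x0) - v) / r) \<le> 1 - u x"
    by (simp add: algebra_simps)
  then show ?thesis using t by (simp add: slope_def t_def[symmetric] field_simps)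
qed

text \<open>A strong maximum principle for the blow-ups of \<open>u\<close> at \<open>x0\<close>: if the lower limit of the slope
  were smaller than \<open>1 / r\<close>, tilting by \<open>\<beta> c \<cdot> (x - x0)\<close> towards the steepest direction would
  produce an asymptotic maximum off the axis of \<open>c\<close>.\<close>

lemma asymptotic_slope:
  assumes card: "CARD('n) \<ge> 2" and m: "m < 1 / r"
  shows "eventually (\<lambda>x. m \<le> slope x) (at x0)"
proof -
  obtain \<mu> where \<mu>: "\<mu> > 0" "\<And>x. x \<in> \<Omega>0 \<Longrightarrow> x \<noteq> x0 \<Longrightarrow> \<mu> \<le> slope x" using slope_lower_bound by blast
  have near: "eventually (\<lambda>x. x \<noteq> x0 \<and> x \<in> \<Omega>0 \<and> norm (x - x0) < r) (at x0)"
    using eventually_near r_pos .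
  have "eventually (\<lambda>x. \<bar>- slope x\<bar> \<le> 1 / r) (at x0)"
    using near by eventually_elim (use slope_le \<mu> in fastforce)
  from bounded_Limsup_real[OF _ this] obtain L where
    L: "\<And>\<epsilon>. \<epsilon> > 0 \<Longrightarrow> eventually (\<lambda>x. - slope x \<le> L + \<epsilon>) (at x0)"
       "\<And>\<epsilon>. \<epsilon> > 0 \<Longrightarrow> frequently (\<lambda>x. - slope x \<ge> L - \<epsilon>) (at x0)" by auto
  \<comment> \<open>The lower limit of the slope at the pole.\<close>
  define m0 where "m0 = - L"
  have above: "eventually (\<lambda>x. m0 - \<epsilon> \<le> slope x) (at x0)" if "\<epsilon> > 0" for \<epsilon>
    using L(1)[OF that] by eventually_elim (simp add: m0_def)
  have below: "frequently (\<lambda>x. slope x \<le> m0 + \<epsilon>) (at x0)" if "\<epsilon> > 0" for \<epsilon>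
    using L(2)[OF that] by (rule frequently_elim1) (simp add: m0_def)
  have m0: "m0 > 0"
  proof -
    obtain x where "slope x \<le> m0 + \<mu> / 2" "x \<noteq> x0 \<and> x \<in> \<Omega>0 \<and> norm (x - x0) < r"
      using frequently_eventually_ex[OF below near, of "\<mu> / 2"] \<mu>(1) by fastforce
    then show ?thesis using \<mu>(1) \<mu>(2)[of x] by simp
  qed
  have "m0 \<ge> 1 / r"
  proof (rule ccontr)
    define gap where "gap = 1 / r - m0"
    assume "\<not> ?thesis"
    then have gap: "gap > 0" by (simp add: gap_def)
    have gap_eq: "1 / r = m0 + gap" by (simp add: gap_def)
    obtain v where v: "norm v = 1" "\<And>t. 0 \<le> t \<Longrightarrow> t < r \<Longrightarrow> x0 + t *\<^sub>R v \<in> \<Omega>0"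
      "\<And>t. 0 \<le> t \<Longrightarrow> t < r \<Longrightarrow> u (x0 + t *\<^sub>R v) = 1 - t / r" using steepest_segment by blast
    obtain c' where c': "norm c' = 1" "c' \<noteq> v" "norm (c' - v) \<le> gap * r / 4"
      using unit_vector_nearby[OF card v(1), of "gap * r / 4"] gap r_pos by auto
    \<comment> \<open>If the directions of nearly minimal slope e approached both -c' and -v to
      within squared distance 2 \<theta>, then |c' - v|^2 would be less than 8 \<theta>. So for one
      of the two tilts they frequently stay away from the antipode of the tilt.\<close>
    define \<theta> where "\<theta> = (norm (c' - v))\<^sup>2 / 8"
    have \<theta>: "\<theta> > 0" using c' by (simp add: \<theta>_def)
    have "\<exists>c. norm c = 1 \<and> norm (c - v) \<le> gap * r / 4 \<and>
       (\<forall>\<epsilon>>0. frequently (\<lambda>x. slope x \<le> m0 + \<epsilon> \<and> c \<bullet> sgn (x - x0) \<ge> \<theta> - 1) (at x0))"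
    proof (rule ccontr)
      assume neg: "\<not> ?thesis"
      have ex: "\<exists>\<epsilon>>0. eventually (\<lambda>x. \<not> (slope x \<le> m0 + \<epsilon> \<and> c \<bullet> sgn (x - x0) \<ge> \<theta> - 1)) (at x0)"
        if "norm c = 1" "norm (c - v) \<le> gap * r / 4" for c
        using neg that unfolding frequently_def by blast
      obtain \<epsilon>1 where \<epsilon>1: "\<epsilon>1 > 0"
        "eventually (\<lambda>x. \<not> (slope x \<le> m0 + \<epsilon>1 \<and> c' \<bullet> sgn (x - x0) \<ge> \<theta> - 1)) (at x0)"
        using ex[OF c'(1,3)] by blast
      obtain \<epsilon>2 where \<epsilon>2: "\<epsilon>2 > 0"
        "eventually (\<lambda>x. \<not> (slope x \<le> m0 + \<epsilon>2 \<and> v \<bullet> sgn (x - x0) \<ge> \<theta> - 1)) (at x0)"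
        using ex[OF v(1)] gap r_pos by auto
      have "min \<epsilon>1 \<epsilon>2 > 0" using \<epsilon>1 \<epsilon>2 by simp
      from frequently_eventually_ex[OF below[OF this] eventually_conj[OF near eventually_conj[OF \<epsilon>1(2) \<epsilon>2(2)]]]
      obtain x where x': "slope x \<le> m0 + min \<epsilon>1 \<epsilon>2" "x \<noteq> x0"
        "\<not> (slope x \<le> m0 + \<epsilon>1 \<and> c' \<bullet> sgn (x - x0) \<ge> \<theta> - 1)"
        "\<not> (slope x \<le> m0 + \<epsilon>2 \<and> v \<bullet> sgn (x - x0) \<ge> \<theta> - 1)" by blast
      then have x: "x \<noteq> x0" "c' \<bullet> sgn (x - x0) < \<theta> - 1" "v \<bullet> sgn (x - x0) < \<theta> - 1" by linarith+
      have e: "norm (sgn (x - x0)) = 1" using x(1) by (simp add: norm_sgn)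
      have "(norm (c' + sgn (x - x0)))\<^sup>2 < 2 * \<theta>" "(norm (v + sgn (x - x0)))\<^sup>2 < 2 * \<theta>"
        unfolding unit_vectors_dist_sq(2)[OF c'(1) e] unit_vectors_dist_sq(2)[OF v(1) e] using x by auto
      moreover have "(norm (c' - v))\<^sup>2 \<le> 2 * (norm (c' + sgn (x - x0)))\<^sup>2 + 2 * (norm (v + sgn (x - x0)))\<^sup>2"
      proof -
        have "norm (c' - v) \<le> norm (c' + sgn (x - x0)) + norm (v + sgn (x - x0))"
          using norm_triangle_ineq4[of "c' + sgn (x - x0)" "v + sgn (x - x0)"] by simp
        then have "(norm (c' - v))\<^sup>2 \<le> (norm (c' + sgn (x - x0)) + norm (v + sgn (x - x0)))\<^sup>2"
          by (intro power_mono) auto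
        also have "\<dots> \<le> 2 * (norm (c' + sgn (x - x0)))\<^sup>2 + 2 * (norm (v + sgn (x - x0)))\<^sup>2"
          using sum_squares_bound[of "norm (c' + sgn (x - x0))" "norm (v + sgn (x - x0))"]
          by (simp add: power2_sum)
        finally show ?thesis .
      qed
      ultimately show False by (simp add: \<theta>_def)
    qed
    then obtain c where c: "norm c = 1" "norm (c - v) \<le> gap * r / 4"
      and freq: "\<And>\<epsilon>. \<epsilon> > 0 \<Longrightarrow> frequently (\<lambda>x. slope x \<le> m0 + \<epsilon> \<and> c \<bullet> sgn (x - x0) \<ge> \<theta> - 1) (at x0)"
      by blast
    \<comment> \<open>The bound by \<open>gap\<close> makes the tilt too weak to compensate for the
      larger slope near \<open>v\<close>; the bound by \<open>m0\<close> keeps the upper limit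
      \<open>K\<close> of the tilted quotient negative, so that \<open>- K\<close> is a legitimate
      cone slope.\<close>
    define \<beta> where "\<beta> = min (gap / 16) (m0 / 2)"
    have \<beta>: "\<beta> > 0" "\<beta> \<le> gap / 16" "\<beta> \<le> m0 / 2" using gap m0 by (auto simp: \<beta>_def)
    define J where "J x = - slope x + \<beta> * (c \<bullet> sgn (x - x0))" for x
    have cs: "\<bar>c \<bullet> sgn (x - x0)\<bar> \<le> 1" for x
      using Cauchy_Schwarz_ineq2[of c "sgn (x - x0)"] c(1) by (auto simp: norm_sgn split: if_splits)
    have \<beta>cs: "\<bar>\<beta> * (c \<bullet> sgn (x - x0))\<bar> \<le> \<beta>" for x
      using mult_left_mono[OF cs[of x], of \<beta>] \<beta>(1) by (simp add: abs_mult)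
    have "eventually (\<lambda>x. \<bar>J x\<bar> \<le> 1 / r + \<beta>) (at x0)"
      using near
    proof eventually_elim
      case (elim x)
      then have "\<mu> \<le> slope x" "slope x \<le> 1 / r" using slope_le[of x] \<mu>(2)[of x] by auto
      then show ?case using \<beta>cs[of x] \<mu>(1) unfolding J_def by linarith
    qed
    from bounded_Limsup_real[OF _ this] obtain K where
      K: "\<And>\<epsilon>. \<epsilon> > 0 \<Longrightarrow> eventually (\<lambda>x. J x \<le> K + \<epsilon>) (at x0)"
         "\<And>\<epsilon>. \<epsilon> > 0 \<Longrightarrow> frequently (\<lambda>x. J x \<ge> K - \<epsilon>) (at x0)" by auto
    have Kneg: "K < 0"
    proof -
      have "m0 / 8 > 0" using m0 by simp
      from frequently_eventually_ex[OF K(2)[OF this] above[OF this]]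
      obtain x where "J x \<ge> K - m0 / 8" "m0 - m0 / 8 \<le> slope x" by blast
      then show ?thesis using \<beta>cs[of x] \<beta>(3) m0 unfolding J_def by linarith
    qed
    \<comment> \<open>Near the direction \<open>- c\<close> the quotient \<open>J\<close> is
      asymptotically at most about \<open>- m0 - \<beta>\<close>. The choice of \<open>c\<close>
      lifts \<open>K\<close> above this value by a fixed amount.\<close>
    have Klow: "K \<ge> - m0 - \<beta> + \<beta> * \<theta>"
    proof (rule field_le_epsilon)
      fix \<epsilon> :: real assume "\<epsilon> > 0"
      then have \<epsilon>: "\<epsilon> / 2 > 0" by simp
      from frequently_eventually_ex[OF freq[OF \<epsilon>] K(1)[OF \<epsilon>]]
      obtain x where x: "slope x \<le> m0 + \<epsilon> / 2" "c \<bullet> sgn (x - x0) \<ge> \<theta> - 1" "J x \<le> K + \<epsilon> / 2" by blast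
      have "\<beta> * (\<theta> - 1) \<le> \<beta> * (c \<bullet> sgn (x - x0))" using x(2) \<beta>(1) by (intro mult_left_mono) auto
      then show "- m0 - \<beta> + \<beta> * \<theta> \<le> K + \<epsilon>" using x(1,3) unfolding J_def by (simp add: algebra_simps)
    qed
    \<comment> \<open>Nearly axial directions must be close enough to \<open>- c\<close> to lose
      almost the whole tilt, or close enough to \<open>c\<close> to lie within
      \<open>gap * r / 2\<close> of \<open>v\<close>.\<close>
    define \<omega> where "\<omega> = min (min (\<theta> / 8) (1/2)) ((gap * r / 8)\<^sup>2)"
    have \<omega>: "\<omega> > 0" "\<omega> \<le> \<theta> / 8" "\<omega> \<le> 1/2" "\<omega> \<le> (gap * r / 8)\<^sup>2"
      using \<theta> gap r_pos by (auto simp: \<omega>_def)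
    have csn: "c \<bullet> sgn (x - x0) = (c \<bullet> (x - x0)) / norm (x - x0)" for x
      by (simp add: sgn_div_norm divide_inverse mult.commute)
    have J_eq: "J x * norm (x - x0) = u x - 1 + \<beta> * (c \<bullet> (x - x0))" if "x \<noteq> x0" for x
      using that by (simp add: J_def slope_def csn field_simps)
    have "eventually (\<lambda>x. u x - 1 + \<beta> * (c \<bullet> (x - x0)) \<le> (\<epsilon> - (- K)) * norm (x - x0)) (at x0)"
      if "\<epsilon> > 0" for \<epsilon>
      using eventually_conj[OF near K(1)[OF that]]
    proof eventually_elim
      case (elim x)
      then have "J x * norm (x - x0) \<le> (\<epsilon> - (- K)) * norm (x - x0)" by (intro mult_right_mono) auto
      then show ?case using J_eq[of x] elim by simp
    qed
    moreover have "- K > 0" using Kneg by simp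
    ultimately obtain \<epsilon>0 where \<epsilon>0: "\<epsilon>0 > 0"
      "eventually (\<lambda>x. \<bar>c \<bullet> (x - x0)\<bar> \<le> (1 - 2 * \<omega>) * norm (x - x0) \<longrightarrow>
        u x - 1 + \<beta> * (c \<bullet> (x - x0)) < (- (- K) - \<epsilon>0) * norm (x - x0)) (at x0)"
      using off_axis_strict[OF c(1) \<beta>(1) _ \<omega>(1,3)] by blast
    define \<epsilon> where "\<epsilon> = min \<epsilon>0 (\<beta> * \<theta> / 8)"
    have \<epsilon>: "\<epsilon> > 0" "\<epsilon> \<le> \<epsilon>0" "\<epsilon> \<le> \<beta> * \<theta> / 8" using \<epsilon>0 \<beta> \<theta> by (auto simp: \<epsilon>_def)
    from frequently_eventually_ex[OF K(2)[OF \<epsilon>(1)]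
        eventually_conj[OF near eventually_conj[OF above[OF \<epsilon>(1)] \<epsilon>0(2)]]]
    obtain x where Jx: "J x \<ge> K - \<epsilon>" and x: "x \<noteq> x0" "x \<in> \<Omega>0" "norm (x - x0) < r"
      and sx: "m0 - \<epsilon> \<le> slope x"
      and off: "\<bar>c \<bullet> (x - x0)\<bar> \<le> (1 - 2 * \<omega>) * norm (x - x0) \<longrightarrow>
        u x - 1 + \<beta> * (c \<bullet> (x - x0)) < (- (- K) - \<epsilon>0) * norm (x - x0)" by blast
    define e where "e = sgn (x - x0)"
    have e: "norm e = 1" using x by (simp add: e_def norm_sgn)
    have "(K - \<epsilon>0) * norm (x - x0) \<le> J x * norm (x - x0)" using Jx \<epsilon>(2) by (intro mult_right_mono) auto
    then have "\<not> \<bar>c \<bullet> (x - x0)\<bar> \<le> (1 - 2 * \<omega>) * norm (x - x0)" using off J_eq[OF x(1)] by auto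
    then have axis: "1 - 2 * \<omega> < \<bar>c \<bullet> e\<bar>"
      using x(1) unfolding e_def csn by (simp add: not_le less_divide_eq)
    have \<beta>\<theta>: "\<beta> * \<theta> > 0" using \<beta> \<theta> by simp
    show False
    \<comment> \<open>Only the two ends of the axis remain: near \<open>c\<close> the slope is too
      large, near \<open>- c\<close> the tilt is too negative for \<open>J\<close> to come close to
      \<open>K\<close>.\<close>
    proof (cases "c \<bullet> e \<ge> 0")
      case True
      have "(norm (e - c))\<^sup>2 < 4 * \<omega>"
        unfolding unit_vectors_dist_sq(1)[OF e c(1)] using axis True by (simp add: inner_commute)
      also have "\<dots> \<le> (2 * (gap * r / 8))\<^sup>2" using \<omega>(4) unfolding power_mult_distrib by simp
      finally have "norm (e - c) \<le> 2 * (gap * r / 8)"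
        by (rule power_less_imp_less_base[THEN less_imp_le]) (use gap r_pos in auto)
      moreover have "norm (e - v) \<le> norm (e - c) + norm (c - v)"
        using norm_triangle_ineq[of "e - c" "c - v"] by simp
      ultimately have "norm (e - v) \<le> gap * r / 2" using c(2) by simp
      then have "norm (e - v) / r \<le> gap / 2" using r_pos by (simp add: field_simps)
      moreover have sd: "1 / r - norm (e - v) / r \<le> slope x"
        unfolding e_def by (rule slope_direction) (use v x in auto)
      ultimately have "slope x \<ge> m0 + gap / 2"
        using gap_eq by linarith
      then have "J x \<le> - m0 - gap / 2 + \<beta>" using \<beta>cs[of x] unfolding J_def by linarith
      then show False using Jx Klow \<epsilon>(3) \<beta>\<theta> \<beta>(2) gap by linarith
    next
      case False
      then have "\<beta> * (c \<bullet> e) \<le> \<beta> * (- (1 - 2 * (\<theta> / 8)))"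
        using axis \<omega>(2) \<beta>(1) by (intro mult_left_mono) auto
      then have "J x \<le> - m0 + \<epsilon> - \<beta> + \<beta> * \<theta> / 4"
        using sx unfolding J_def e_def by (simp add: algebra_simps)
      then show False using Jx Klow \<epsilon>(3) \<beta>\<theta> by linarith
    qed
  qed
  then have "1 / r - m > 0" "m \<le> m0 - (1 / r - m)" using m by auto
  then show ?thesis using above[of "1 / r - m"] by (auto elim: eventually_mono)
qed

lemma concave_imp_ball:
  assumes card: "CARD('n) \<ge> 2" and conc: "concave_on \<Omega>0 u"
  shows "\<Omega>0 = ball x0 r"
proof (rule ball_rigidity)
  fix x assume x: "x \<in> \<Omega>0" "x \<noteq> x0"
  define X where "X = x - x0"
  have X: "norm X > 0" using x by (simp add: X_def)
  have le: "m * norm X \<le> 1 - u x" if m: "m < 1 / r" for m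
  proof -
    obtain d where d: "d > 0" "\<And>y. y \<noteq> x0 \<Longrightarrow> norm (y - x0) < d \<Longrightarrow> m \<le> slope y"
      using asymptotic_slope[OF card m] unfolding eventually_at by (auto simp: dist_norm)
    \<comment> \<open>Moves along the ray to a point where the asymptotic bound already holds;
      concavity then carries it back to \<open>x\<close>.\<close>
    define t where "t = min 1 (d / (2 * norm X))"
    have t: "0 < t" "t \<le> 1" using d X by (auto simp: t_def)
    have "t * norm X \<le> d / (2 * norm X) * norm X" using X by (intro mult_right_mono) (auto simp: t_def)
    then have td: "t * norm X < d" using d X by simp
    have "(1 - t) * u x0 + t * u x \<le> u ((1 - t) *\<^sub>R x0 + t *\<^sub>R x)"
      using concave_onD[OF conc _ _ x0 x(1), of t] t by simp
    moreover have "(1 - t) *\<^sub>R x0 + t *\<^sub>R x = x0 + t *\<^sub>R X"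
      by (simp add: X_def algebra_simps)
    ultimately have cv: "1 - u (x0 + t *\<^sub>R X) \<le> t * (1 - u x)" by (simp add: u_x0 algebra_simps)
    have "m \<le> slope (x0 + t *\<^sub>R X)" using t X td by (intro d(2)) auto
    then have "m * (t * norm X) \<le> 1 - u (x0 + t *\<^sub>R X)"
      using t X by (simp add: slope_def field_simps)
    then have "t * (m * norm X) \<le> t * (1 - u x)" using cv by (simp add: mult_ac)
    then show ?thesis using t by simp
  qed
  show "norm (x - x0) / r \<le> 1 - u x"
  proof (rule ccontr)
    assume "\<not> ?thesis"
    then have "(1 - u x) / norm X < 1 / r" using X r_pos by (simp add: X_def field_simps)
    then obtain m where "(1 - u x) / norm X < m" "m < 1 / r" using dense by blast
    then show False using le[of m] X by (simp add: field_simps)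
  qed
qed

end


subsection \<open>Critical points of smooth solutions\<close>

lemma C2_dataD:
  assumes "C2_data S f g H" "x \<in> S"
  shows "(f has_derivative (\<lambda>h. g x \<bullet> h)) (at x)" "(g has_derivative H x) (at x)"
  using assms by (auto simp: C2_data_def)

lemma C2_data_grad_sq_derivative:
  assumes C: "C2_data S f g H" and x: "x \<in> S"
  shows "((\<lambda>x. g x \<bullet> g x) has_derivative (\<lambda>h. 2 * (g x \<bullet> H x h))) (at x)"
  by (rule has_derivative_eq_rhs[OF has_derivative_inner[OF C2_dataD(2)[OF C x] C2_dataD(2)[OF C x]]])
    (simp add: fun_eq_iff inner_commute)

lemma C2_data_continuous:
  assumes "C2_data S f g H"
  shows "continuous_on S f" "continuous_on S g"
  using C2_dataD[OF assms] by (meson continuous_at_imp_continuous_on has_derivative_continuous)+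

text \<open>Along \<open>x + h Du + h\<^sup>2/2 D\<^sup>2u Du\<close>, the second order Taylor polynomial of the gradient curve through
  \<open>x\<close>, the function \<open>|Du|\<^sup>2\<close> is constant up to \<open>o(h\<^sup>2)\<close>.\<close>

lemma grad_sq_no_touching_below:
  fixes f :: "real^'n \<Rightarrow> real"
  assumes C: "C2_data S f g H" and S: "open S" "x \<in> S"
    and lap: "\<And>x. x \<in> S \<Longrightarrow> g x \<bullet> H x (g x) = 0"
    and xz: "x \<noteq> z" and \<epsilon>: "\<epsilon> > 0" and small: "g x \<bullet> g x < \<epsilon> / ((x - z) \<bullet> (x - z))"
    and e: "e > 0" and min: "\<And>y. dist y x < e \<Longrightarrow>
      g x \<bullet> g x - \<epsilon> / ((x - z) \<bullet> (x - z)) \<le> g y \<bullet> g y - \<epsilon> / ((y - z) \<bullet> (y - z))"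
  shows False
proof -
  define Y V W where "Y = x - z" and "V = g x" and "W = H x V"
  define D where "D = Y \<bullet> Y"
  have D: "D > 0" using xz by (simp add: D_def Y_def)
  have dG: "((\<lambda>y. g y \<bullet> g y - \<epsilon> / ((y - z) \<bullet> (y - z))) has_derivative
      (\<lambda>h. 2 * (g y \<bullet> H y h) + 2 * \<epsilon> * ((y - z) \<bullet> h) / ((y - z) \<bullet> (y - z))\<^sup>2)) (at y)"
    if "y \<in> S" "y \<noteq> z" for y
  proof -
    have "((\<lambda>y. (y - z) \<bullet> (y - z)) has_derivative (\<lambda>h. (y - z) \<bullet> h + h \<bullet> (y - z))) (at y)"
      by (auto intro!: derivative_eq_intros)
    then have "((\<lambda>y. \<epsilon> / ((y - z) \<bullet> (y - z))) has_derivative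
        (\<lambda>h. - (2 * \<epsilon> * ((y - z) \<bullet> h) / ((y - z) \<bullet> (y - z))\<^sup>2))) (at y)"
      using that(2) by (auto intro!: derivative_eq_intros simp: fun_eq_iff inner_commute power2_eq_square divide_inverse)
    from has_derivative_diff[OF C2_data_grad_sq_derivative[OF C that(1)] this] show ?thesis by simp
  qed
  have "(\<lambda>h. 2 * (g x \<bullet> H x h) + 2 * \<epsilon> * ((x - z) \<bullet> h) / ((x - z) \<bullet> (x - z))\<^sup>2) = (\<lambda>h. 0)"
    by (rule differential_zero_maxmin[OF _ open_ball dG[OF S(2) xz], of x e])
      (use e min in \<open>auto simp: dist_commute\<close>)
  then have crit: "2 * (V \<bullet> H x h) + 2 * \<epsilon> * (Y \<bullet> h) / D\<^sup>2 = 0" for h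
    unfolding V_def Y_def D_def by meson
  have VW: "V \<bullet> W = 0" using lap[OF S(2)] by (simp add: V_def W_def)
  \<comment> \<open>Du is tangent to the sphere about \<open>z\<close>, so nothing is visible at
    first order; \<open>YW\<close> is the inward acceleration of the gradient curve.\<close>
  then have YV: "Y \<bullet> V = 0" using crit[of V] \<epsilon> D by (simp add: W_def)
  have YW: "Y \<bullet> W = - (\<epsilon> / D)"
  proof -
    have "Y \<bullet> W = V \<bullet> H x Y" unfolding W_def using C2_data_symmetric[OF C S, of V Y] by (simp add: inner_commute)
    moreover have "Y \<bullet> Y / D\<^sup>2 = 1 / D" using D by (simp add: D_def[symmetric] power2_eq_square)
    then have "2 * (V \<bullet> H x Y) + 2 * \<epsilon> * (1 / D) = 0" using crit[of Y] by (simp only: times_divide_eq_right[symmetric])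
    ultimately show ?thesis by simp
  qed
  define \<gamma> where "\<gamma> h = x + h *\<^sub>R V + (h\<^sup>2 / 2) *\<^sub>R W" for h :: real
  define \<phi> where "\<phi> h = g (\<gamma> h) \<bullet> g (\<gamma> h) - \<epsilon> / ((\<gamma> h - z) \<bullet> (\<gamma> h - z))" for h
  define \<phi>' where "\<phi>' h = 2 * (g (\<gamma> h) \<bullet> H (\<gamma> h) (V + h *\<^sub>R W))
      + 2 * \<epsilon> * ((\<gamma> h - z) \<bullet> (V + h *\<^sub>R W)) / ((\<gamma> h - z) \<bullet> (\<gamma> h - z))\<^sup>2" for h
  have \<gamma>0: "\<gamma> 0 = x" by (simp add: \<gamma>_def)
  have d\<gamma>: "(\<gamma> has_derivative (\<lambda>k. k *\<^sub>R (V + h *\<^sub>R W))) (at h)" for h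
    unfolding \<gamma>_def by (auto intro!: derivative_eq_intros simp: fun_eq_iff algebra_simps)
  have \<gamma>lim: "(\<gamma> \<longlongrightarrow> x) (at 0)"
    using has_derivative_continuous[OF d\<gamma>[of 0]] by (simp add: continuous_within \<gamma>0)
  have ev: "eventually (\<lambda>h. \<gamma> h \<in> S \<and> \<gamma> h \<noteq> z \<and> dist (\<gamma> h) x < e) (at 0)"
    using topological_tendstoD[OF \<gamma>lim S] tendsto_imp_eventually_ne[OF \<gamma>lim xz] tendstoD[OF \<gamma>lim e]
    by eventually_elim simp
  have d\<phi>: "(\<phi> has_real_derivative \<phi>' h) (at h)" if "\<gamma> h \<in> S" "\<gamma> h \<noteq> z" for h
  proof -
    interpret bounded_linear "H (\<gamma> h)" by (rule C2_data_linear[OF C that(1)])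
    have "(\<phi> has_derivative (\<lambda>k. 2 * (g (\<gamma> h) \<bullet> H (\<gamma> h) (k *\<^sub>R (V + h *\<^sub>R W)))
      + 2 * \<epsilon> * ((\<gamma> h - z) \<bullet> (k *\<^sub>R (V + h *\<^sub>R W))) / ((\<gamma> h - z) \<bullet> (\<gamma> h - z))\<^sup>2)) (at h)"
      unfolding \<phi>_def using has_derivative_compose[OF d\<gamma> dG[OF that]] .
    then show ?thesis
      unfolding has_field_derivative_def
      by (rule has_derivative_eq_rhs) (simp add: fun_eq_iff \<phi>'_def scaleR distrib_left distrib_right mult_ac)
  qed
  \<comment> \<open>Since H(Du) is orthogonal to Du at every point, the velocity of the curve may be
    replaced by its difference from Du, which is o(h) by differentiability of \<open>g\<close>.
    Hence one continuous \<open>H\<close> is enough and no third derivative of \<open>f\<close>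
    occurs.\<close>
  have lim1: "((\<lambda>h. g (\<gamma> h) \<bullet> H (\<gamma> h) (V + h *\<^sub>R W) / h) \<longlongrightarrow> 0) (at 0)"
  proof -
    have "((\<lambda>h. g (\<gamma> h)) has_derivative (\<lambda>k. H x (k *\<^sub>R V))) (at 0)"
      using has_derivative_compose[OF d\<gamma>[of 0], of g "H x"] C2_dataD(2)[OF C S(2)] by (simp add: \<gamma>0)
    then have lim0: "((\<lambda>h. norm (g (\<gamma> h) - V - h *\<^sub>R W) / norm h) \<longlongrightarrow> 0) (at 0)"
      using linear_cmul[OF bounded_linear.linear[OF C2_data_linear[OF C S(2)]]]
      by (simp add: has_derivative_iff_norm \<gamma>0 V_def[symmetric] W_def)
    have "((\<lambda>h. norm (W - (g (\<gamma> h) - V) /\<^sub>R h)) \<longlongrightarrow> 0) (at 0)"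
    proof (rule Lim_transform_eventually[OF lim0])
      show "eventually (\<lambda>h. norm (g (\<gamma> h) - V - h *\<^sub>R W) / norm h = norm (W - (g (\<gamma> h) - V) /\<^sub>R h)) (at 0)"
        using eventually_neq_at_within[of 0 0 UNIV]
      proof eventually_elim
        case (elim h)
        then have "W - (g (\<gamma> h) - V) /\<^sub>R h = (- inverse h) *\<^sub>R (g (\<gamma> h) - V - h *\<^sub>R W)"
          by (simp add: algebra_simps)
        then have "norm (W - (g (\<gamma> h) - V) /\<^sub>R h) = \<bar>inverse h\<bar> * norm (g (\<gamma> h) - V - h *\<^sub>R W)"
          by simp
        then show ?case by (simp add: divide_inverse mult.commute)
      qed
    qed
    then have "((\<lambda>h. W - (g (\<gamma> h) - V) /\<^sub>R h) \<longlongrightarrow> 0) (at 0)" by (rule tendsto_norm_zero_cancel)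
    then have "((\<lambda>h. H (\<gamma> h) (W - (g (\<gamma> h) - V) /\<^sub>R h)) \<longlongrightarrow> H x 0) (at 0)"
      by (intro C2_data_tendsto[OF C S \<gamma>lim]) simp
    moreover have "H x 0 = 0" using C2_data_linear[OF C S(2)] by (simp add: linear_0 bounded_linear.linear)
    moreover have "((\<lambda>h. g (\<gamma> h)) \<longlongrightarrow> V) (at 0)"
      unfolding V_def using has_derivative_continuous[OF C2_dataD(2)[OF C S(2)]] \<gamma>lim
      by (rule isCont_tendsto_compose)
    ultimately have "((\<lambda>h. g (\<gamma> h) \<bullet> H (\<gamma> h) (W - (g (\<gamma> h) - V) /\<^sub>R h)) \<longlongrightarrow> V \<bullet> 0) (at 0)"
      by (intro tendsto_inner) simp_all
    moreover have "eventually (\<lambda>h. g (\<gamma> h) \<bullet> H (\<gamma> h) (W - (g (\<gamma> h) - V) /\<^sub>R h)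
        = g (\<gamma> h) \<bullet> H (\<gamma> h) (V + h *\<^sub>R W) / h) (at 0)"
      using ev eventually_neq_at_within[of 0 0 UNIV]
    proof eventually_elim
      case (elim h)
      then interpret bounded_linear "H (\<gamma> h)" using C2_data_linear[OF C] by blast
      have "W - (g (\<gamma> h) - V) /\<^sub>R h = (V + h *\<^sub>R W) /\<^sub>R h - g (\<gamma> h) /\<^sub>R h"
        using elim by (simp add: algebra_simps)
      then have "H (\<gamma> h) (W - (g (\<gamma> h) - V) /\<^sub>R h) = H (\<gamma> h) (V + h *\<^sub>R W) /\<^sub>R h - H (\<gamma> h) (g (\<gamma> h)) /\<^sub>R h"
        by (simp only: diff scaleR)
      then show ?case using lap[of "\<gamma> h"] elim by (simp add: inner_diff_right divide_inverse mult.commute)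
    qed
    ultimately show ?thesis by (simp add: tendsto_cong)
  qed
  \<comment> \<open>The limit is half the second derivative of the squared distance from
    \<open>z\<close> along the curve. By \<open>YW\<close> and \<open>small\<close> it is negative:
    the curve bends into the sphere, where the barrier is larger.\<close>
  have lim2: "((\<lambda>h. (\<gamma> h - z) \<bullet> (V + h *\<^sub>R W) / h) \<longlongrightarrow> V \<bullet> V + Y \<bullet> W) (at 0)"
  proof -
    have eq: "(\<gamma> h - z) \<bullet> (V + h *\<^sub>R W) = h * (V \<bullet> V + Y \<bullet> W + h\<^sup>2 / 2 * (W \<bullet> W))" for h
    proof -
      have "\<gamma> h - z = Y + h *\<^sub>R V + (h\<^sup>2 / 2) *\<^sub>R W" by (simp add: \<gamma>_def Y_def)
      then show ?thesis using VW YV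
        by (simp add: inner_add_left inner_add_right inner_commute algebra_simps power2_eq_square)
    qed
    have "((\<lambda>h. V \<bullet> V + Y \<bullet> W + h\<^sup>2 / 2 * (W \<bullet> W)) \<longlongrightarrow> V \<bullet> V + Y \<bullet> W + 0\<^sup>2 / 2 * (W \<bullet> W)) (at 0)"
      by (intro tendsto_intros) simp
    moreover have "eventually (\<lambda>h. V \<bullet> V + Y \<bullet> W + h\<^sup>2 / 2 * (W \<bullet> W) = (\<gamma> h - z) \<bullet> (V + h *\<^sub>R W) / h) (at 0)"
      using eventually_neq_at_within[of 0 0 UNIV] by eventually_elim (simp add: eq)
    ultimately show ?thesis by (simp add: tendsto_cong)
  qed
  have "((\<lambda>h. (\<gamma> h - z) \<bullet> (\<gamma> h - z)) \<longlongrightarrow> D) (at 0)"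
    unfolding D_def Y_def by (intro tendsto_intros \<gamma>lim)
  then have "((\<lambda>h. 2 * (g (\<gamma> h) \<bullet> H (\<gamma> h) (V + h *\<^sub>R W) / h)
      + 2 * \<epsilon> * ((\<gamma> h - z) \<bullet> (V + h *\<^sub>R W) / h) / ((\<gamma> h - z) \<bullet> (\<gamma> h - z))\<^sup>2)
      \<longlongrightarrow> 2 * 0 + 2 * \<epsilon> * (V \<bullet> V + Y \<bullet> W) / D\<^sup>2) (at 0)"
    using D by (intro tendsto_add tendsto_mult tendsto_divide tendsto_power tendsto_const lim1 lim2) auto
  then have lim: "((\<lambda>h. \<phi>' h / h) \<longlongrightarrow> 2 * \<epsilon> * (V \<bullet> V + Y \<bullet> W) / D\<^sup>2) (at 0)"
    by (simp add: \<phi>'_def add_divide_distrib mult.commute)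
  have "V \<bullet> V + Y \<bullet> W < 0" using small YW by (simp add: D_def Y_def V_def)
  then have "2 * \<epsilon> * (V \<bullet> V + Y \<bullet> W) / D\<^sup>2 < 0"
    using \<epsilon> D by (intro divide_neg_pos mult_pos_neg) auto
  with lim have "eventually (\<lambda>h. \<phi>' h / h < 0) (at 0)" by (rule order_tendstoD(2))
  with ev have "eventually (\<lambda>h. (\<gamma> h \<in> S \<and> \<gamma> h \<noteq> z \<and> dist (\<gamma> h) x < e) \<and> \<phi>' h / h < 0) (at 0)"
    by (rule eventually_conj)
  then obtain d where d: "d > 0" and dP: "\<And>h. h \<noteq> 0 \<Longrightarrow> dist h 0 < d \<Longrightarrow>
      (\<gamma> h \<in> S \<and> \<gamma> h \<noteq> z \<and> dist (\<gamma> h) x < e) \<and> \<phi>' h / h < 0"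
    unfolding eventually_at by auto
  have in_S: "\<gamma> h \<in> S" "\<gamma> h \<noteq> z" if "0 \<le> h" "h \<le> d / 2" for h
    using dP[of h] that d S xz \<gamma>0 by (cases "h = 0"; auto)+
  have "d / 2 > 0" using d by simp
  from MVT2[OF this, of \<phi> \<phi>'] d\<phi> in_S
  obtain k where k: "0 < k" "k < d / 2" "\<phi> (d / 2) - \<phi> 0 = (d / 2 - 0) * \<phi>' k" by blast
  have "\<phi>' k < 0" using dP[of k] k by (auto simp: divide_less_0_iff)
  then have "(d / 2 - 0) * \<phi>' k < 0" using d by (intro mult_pos_neg) auto
  then have "\<phi> (d / 2) < \<phi> 0" using k(3) by linarith
  moreover have "\<phi> 0 \<le> \<phi> (d / 2)" unfolding \<phi>_def \<gamma>0 using dP[of "d / 2"] d by (intro min) auto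
  ultimately show False by simp
qed

text \<open>The barrier \<epsilon> / |y - z|^2 - \<epsilon> / R^2 lies below |Du|^2 on the annulus,
  which forces linear growth of |Du|^2 inwards from \<open>p\<close>. At a zero of Du, however, the
  derivative of |Du|^2 vanishes.\<close>

lemma grad_nonzero_on_sphere:
  fixes f :: "real^'n \<Rightarrow> real"
  assumes C: "C2_data S f g H" and S: "open S"
    and lap: "\<And>x. x \<in> S \<Longrightarrow> g x \<bullet> H x (g x) = 0"
    and sub: "cball z R \<subseteq> S" and R: "R > 0" and pos: "\<And>x. norm (x - z) < R \<Longrightarrow> g x \<noteq> 0"
    and p: "norm (p - z) = R"
  shows "g p \<noteq> 0"
proof
  assume gp: "g p = 0"
  have nn: "(y - z) \<bullet> (y - z) = (norm (y - z))\<^sup>2" for y by (simp add: power2_norm_eq_inner)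
  define q where "q y = g y \<bullet> g y" for y
  have inS: "y \<in> S" if "norm (y - z) \<le> R" for y
    using sub that by (auto simp: dist_norm norm_minus_commute)
  have qS: "continuous_on S q"
    unfolding q_def by (intro continuous_intros C2_data_continuous(2)[OF C])
  define M where "M = {y. R / 2 \<le> norm (y - z) \<and> norm (y - z) \<le> R}"
  have "M = cball z R - ball z (R / 2)" by (auto simp: M_def dist_norm norm_minus_commute not_less)
  then have cM: "compact M" by (simp add: compact_diff)
  have MS: "M \<subseteq> S" using inS by (auto simp: M_def)
  have "p \<in> M" using p R by (auto simp: M_def)
  define \<Sigma> where "\<Sigma> = sphere z (R / 2)"
  have \<Sigma>: "y \<in> \<Sigma> \<longleftrightarrow> norm (y - z) = R / 2" for y by (simp add: \<Sigma>_def dist_norm norm_minus_commute)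
  have "compact \<Sigma>" "\<Sigma> \<noteq> {}" using R by (simp_all add: \<Sigma>_def)
  moreover have "\<Sigma> \<subseteq> S" using inS \<Sigma> R by auto
  then have "continuous_on \<Sigma> q" using qS continuous_on_subset by blast
  ultimately obtain s where s: "s \<in> \<Sigma>" "\<And>y. y \<in> \<Sigma> \<Longrightarrow> q s \<le> q y"
    using continuous_attains_inf[of \<Sigma> q] by blast
  have qs: "q s > 0" using pos[of s] s(1) \<Sigma> R by (simp add: q_def)
  \<comment> \<open>Chosen so that the barrier equals exactly the minimum \<open>q s\<close> of
    |Du|^2 on the inner sphere of radius \<open>R / 2\<close>; on the outer sphere it is
    zero.\<close>
  define \<epsilon> where "\<epsilon> = q s * R\<^sup>2 / 3"
  have \<epsilon>: "\<epsilon> > 0" using qs R by (simp add: \<epsilon>_def)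
  define G where "G y = q y - \<epsilon> / ((y - z) \<bullet> (y - z))" for y
  have "continuous_on M G"
    unfolding G_def using R by (intro continuous_intros continuous_on_subset[OF qS MS]) (auto simp: M_def)
  then obtain m where m: "m \<in> M" "\<And>y. y \<in> M \<Longrightarrow> G m \<le> G y"
    using continuous_attains_inf[OF cM, of G] \<open>p \<in> M\<close> by blast
  have Gm: "- (\<epsilon> / R\<^sup>2) \<le> G m"
  proof (rule ccontr)
    assume neg: "\<not> ?thesis"
    have "norm (m - z) \<noteq> R"
    proof
      assume "norm (m - z) = R"
      then have "- (\<epsilon> / R\<^sup>2) \<le> G m" by (simp add: G_def nn q_def)
      then show False using neg by simp
    qed
    moreover have "norm (m - z) \<noteq> R / 2"
    proof
      assume eq: "norm (m - z) = R / 2"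
      then have "q s \<le> q m" using s(2) \<Sigma> by simp
      moreover have "\<epsilon> / (R / 2)\<^sup>2 = \<epsilon> / R\<^sup>2 + q s" using R by (simp add: \<epsilon>_def field_simps power2_eq_square)
      ultimately have "- (\<epsilon> / R\<^sup>2) \<le> G m" unfolding G_def nn eq by simp
      then show False using neg by simp
    qed
    ultimately have m': "R / 2 < norm (m - z)" "norm (m - z) < R" using m(1) by (auto simp: M_def)
    define e where "e = min (norm (m - z) - R / 2) (R - norm (m - z))"
    have e: "e > 0" using m' by (simp add: e_def)
    have inM: "y \<in> M" if "dist y m < e" for y
    proof -
      have "norm (y - z) \<le> norm (m - z) + norm (y - m)" "norm (m - z) \<le> norm (y - z) + norm (y - m)"
        using norm_triangle_ineq[of "m - z" "y - m"] norm_triangle_ineq4[of "y - z" "y - m"] by simp_all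
      then show ?thesis using that by (simp add: M_def e_def dist_norm)
    qed
    have "q m < \<epsilon> / ((m - z) \<bullet> (m - z))"
    proof -
      have "\<epsilon> / R\<^sup>2 > 0" using \<epsilon> R by simp
      then show ?thesis using neg unfolding G_def by linarith
    qed
    moreover have "m \<noteq> z" using m' R by auto
    moreover have "m \<in> S" using m(1) MS by auto
    ultimately show False
      using grad_sq_no_touching_below[OF C S _ lap _ \<epsilon> _ e, of m z] m(2) inM
      unfolding G_def q_def by blast
  qed
  define y where "y h = p + h *\<^sub>R (z - p)" for h :: real
  have lower: "2 * \<epsilon> / R\<^sup>2 * h \<le> q (y h)" if h: "0 < h" "h \<le> 1/2" for h
  proof -
    have "y h - z = (1 - h) *\<^sub>R (p - z)" by (simp add: y_def algebra_simps)
    then have ny: "norm (y h - z) = (1 - h) * R" using h p by simp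
    have "R / 2 \<le> (1 - h) * R" "(1 - h) * R \<le> R"
      using h R mult_right_mono[of "1/2" "1 - h" R] mult_right_mono[of "1 - h" 1 R] by auto
    then have "y h \<in> M" by (simp add: M_def ny)
    then have "- (\<epsilon> / R\<^sup>2) \<le> G (y h)" using Gm m(2) by force
    then have le: "\<epsilon> / ((1 - h) * R)\<^sup>2 - \<epsilon> / R\<^sup>2 \<le> q (y h)" unfolding G_def nn ny by simp
    have "(1 + 2 * h) * (1 - h)\<^sup>2 = 1 - h\<^sup>2 * (3 - 2 * h)"
      by (simp add: power2_eq_square algebra_simps)
    also have "\<dots> \<le> 1" using h by simp
    finally have "1 + 2 * h \<le> 1 / (1 - h)\<^sup>2" using h by (simp add: le_divide_eq)
    then have "\<epsilon> / R\<^sup>2 * (1 + 2 * h) \<le> \<epsilon> / R\<^sup>2 * (1 / (1 - h)\<^sup>2)" using \<epsilon> by (intro mult_left_mono) auto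
    moreover have "\<epsilon> / ((1 - h) * R)\<^sup>2 = \<epsilon> / R\<^sup>2 * (1 / (1 - h)\<^sup>2)"
      by (simp add: power_mult_distrib mult.commute)
    moreover have "\<epsilon> / R\<^sup>2 * (1 + 2 * h) = \<epsilon> / R\<^sup>2 + 2 * \<epsilon> / R\<^sup>2 * h"
      by (simp add: algebra_simps add_divide_distrib)
    ultimately show ?thesis using le by linarith
  qed
  have pS: "p \<in> S" using inS p by simp
  have y0: "y 0 = p" by (simp add: y_def)
  have dy: "(y has_derivative (\<lambda>h. h *\<^sub>R (z - p))) (at 0)"
    unfolding y_def by (auto intro!: derivative_eq_intros)
  have "(q has_derivative (\<lambda>h. 2 * (g p \<bullet> H p h))) (at (y 0))"
    unfolding q_def y0 by (rule C2_data_grad_sq_derivative[OF C pS])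
  from has_derivative_compose[OF dy this]
  have "((\<lambda>h. q (y h)) has_derivative (\<lambda>h. 2 * (g p \<bullet> H p (h *\<^sub>R (z - p))))) (at 0)" .
  then have "((\<lambda>h. q (y h)) has_real_derivative 0) (at 0)"
    unfolding has_field_derivative_def by (rule has_derivative_eq_rhs) (simp add: gp fun_eq_iff)
  then have "((\<lambda>h. q (y h) / h) \<longlongrightarrow> 0) (at 0)"
    using gp by (simp add: has_field_derivative_iff y0 q_def)
  moreover have "2 * \<epsilon> / R\<^sup>2 > 0" using \<epsilon> R by simp
  ultimately have "eventually (\<lambda>h. q (y h) / h < 2 * \<epsilon> / R\<^sup>2) (at 0)" by (rule order_tendstoD(2))
  then obtain d where d: "d > 0" "\<And>h. h \<noteq> 0 \<Longrightarrow> dist h 0 < d \<Longrightarrow> q (y h) / h < 2 * \<epsilon> / R\<^sup>2"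
    unfolding eventually_at by auto
  define h where "h = min (1/2) (d / 2)"
  have h: "0 < h" "h \<le> 1/2" "h < d" using d by (auto simp: h_def)
  then have "q (y h) < 2 * \<epsilon> / R\<^sup>2 * h" using d(2)[of h] by (simp add: divide_less_eq)
  then show False using lower[OF h(1,2)] by simp
qed

text \<open>If the critical set were nonempty and proper, connectedness would give it a boundary
  point. A nearby noncritical \<open>z\<close> and its nearest critical point form a ball of
  noncritical points touching the critical set, contrary to
  \<open>grad_nonzero_on_sphere\<close>.\<close>

lemma inf_harmonic_C2_no_critical_points:
  fixes f :: "real^'n \<Rightarrow> real"
  assumes C: "C2_data S f g H" and S: "open S" "connected S"
    and lap: "\<And>x. x \<in> S \<Longrightarrow> g x \<bullet> H x (g x) = 0"
    and ex: "w \<in> S" "g w \<noteq> 0" and x: "x \<in> S"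
  shows "g x \<noteq> 0"
proof
  assume "g x = 0"
  define K where "K = {x \<in> S. g x = 0}"
  have cg: "continuous_on S g" by (rule C2_data_continuous(2)[OF C])
  have "closedin (top_of_set S) K"
    unfolding K_def using continuous_closedin_preimage_constant[OF cg] by simp
  moreover have "K \<noteq> {}" "K \<noteq> S" using x \<open>g x = 0\<close> ex by (auto simp: K_def)
  ultimately have "\<not> openin (top_of_set S) K" using S(2) unfolding connected_clopen by blast
  then have "\<not> open K" using S(1) by (auto simp: openin_open_eq K_def)
  then obtain p where p: "p \<in> K" "\<And>e. e > 0 \<Longrightarrow> \<not> ball p e \<subseteq> K"
    unfolding open_contains_ball by blast
  have "p \<in> S" using p by (simp add: K_def)
  then obtain \<rho> where \<rho>: "\<rho> > 0" "cball p \<rho> \<subseteq> S" using S(1) open_contains_cball by blast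
  \<comment> \<open>The nearest critical point is then at distance less than \<rho> / 3 from
    \<open>z\<close>, so the touching ball remains in \<open>cball p \<rho>\<close> and restricting
    the search to \<open>Kc\<close> misses nothing.\<close>
  have "\<not> ball p (\<rho> / 3) \<subseteq> K" using p(2) \<rho> by simp
  then obtain z where z: "z \<in> ball p (\<rho> / 3)" "z \<notin> K" by blast
  define Kc where "Kc = {x \<in> cball p \<rho>. g x = 0}"
  have "closed Kc" unfolding Kc_def
    using continuous_closed_preimage_constant[OF continuous_on_subset[OF cg \<rho>(2)] closed_cball] by simp
  then have "compact Kc" unfolding Kc_def
    by (metis (no_types, lifting) bounded_cball bounded_subset compact_eq_bounded_closed mem_Collect_eq subsetI)
  moreover have pKc: "p \<in> Kc" using p \<rho> by (simp add: Kc_def K_def)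
  moreover have "continuous_on Kc (\<lambda>y. dist z y)" by (intro continuous_intros)
  ultimately obtain y where y: "y \<in> Kc" "\<And>k. k \<in> Kc \<Longrightarrow> dist z y \<le> dist z k"
    using continuous_attains_inf[of Kc "\<lambda>y. dist z y"] by blast
  define R where "R = dist z y"
  have "y \<in> K" using y \<rho> by (auto simp: Kc_def K_def)
  then have R0: "R > 0" using z by (auto simp: R_def)
  have R\<rho>: "R < \<rho> / 3" using y(2)[OF pKc] z by (simp add: R_def dist_commute)
  have in\<rho>: "k \<in> cball p \<rho>" if "dist z k \<le> R" for k
    using dist_triangle[of p k z] that R\<rho> z \<rho> by simp
  have "g y \<noteq> 0"
  proof (rule grad_nonzero_on_sphere[OF C S(1) lap])
    show "cball z R \<subseteq> S" using in\<rho> \<rho> by auto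
    show "R > 0" by (rule R0)
    show "norm (y - z) = R" by (simp add: R_def dist_norm norm_minus_commute)
    show "g k \<noteq> 0" if "norm (k - z) < R" for k
    proof
      assume "g k = 0"
      have zk: "dist z k < R" using that by (simp add: dist_norm norm_minus_commute)
      then have "k \<in> Kc" using in\<rho>[of k] \<open>g k = 0\<close> by (simp add: Kc_def)
      then show False using y(2)[of k] zk by (simp add: R_def)
    qed
  qed
  then show False using y(1) by (simp add: Kc_def)
qed


subsection \<open>Smooth potentials\<close>

locale C2_potential = inf_potential \<Omega>0 x0 u for \<Omega>0 :: "(real^'n) set" and x0 u +
  fixes V :: "real^'n \<Rightarrow> real^'n" and H
  assumes card: "CARD('n) \<ge> 2" and conn: "connected \<Omega>0" and C: "C2_data (\<Omega>0 - {x0}) u V H"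
begin

abbreviation "\<Omega> \<equiv> \<Omega>0 - {x0}"

lemma open_\<Omega>: "open \<Omega>" using opn by (simp add: open_delete)

lemma connected_\<Omega>: "connected \<Omega>"
  using connected_open_delete[OF opn conn] card by simp

lemmas dV = C2_dataD[OF C] and dq = C2_data_grad_sq_derivative[OF C]

text \<open>A smooth \<open>u\<close> is its own test function, from above and from below.\<close>

lemma lap: "x \<in> \<Omega> \<Longrightarrow> V x \<bullet> H x (V x) = 0"
proof -
  assume x: "x \<in> \<Omega>"
  have "0 \<le> inf_lap V H x" using inf_visc_subD[OF sub x open_\<Omega> x subset_refl C] by simp
  moreover have "inf_lap V H x \<le> 0"
    using super[unfolded inf_visc_super_def, rule_format, of x \<Omega> u V H] x open_\<Omega> C by simp
  ultimately show ?thesis by (simp add: inf_lap_def inner_commute)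
qed

text \<open>If |Du| exceeded the slope of the touching cone in \<open>slope_bound\<close>, a short
  step in the direction Du would cross that cone.\<close>

lemma norm_V_le: "x \<in> \<Omega> \<Longrightarrow> norm (V x) * norm (x - x0) \<le> 1 - u x"
proof (rule ccontr)
  assume x: "x \<in> \<Omega>" and neg: "\<not> ?thesis"
  define s where "s = (1 - u x) / norm (x - x0)"
  have "norm (x - x0) > 0" using x by simp
  then have s: "s < norm (V x)" using neg by (simp add: s_def field_simps)
  have s0: "s \<ge> 0" using u_le_one[of x] x by (simp add: s_def)
  define y where "y t = x + t *\<^sub>R V x" for t :: real
  have dy: "(y has_derivative (\<lambda>t. t *\<^sub>R V x)) (at 0)"
    unfolding y_def by (auto intro!: derivative_eq_intros)
  have y0: "y 0 = x" by (simp add: y_def)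
  have "(u has_derivative (\<lambda>h. V x \<bullet> h)) (at (y 0))" unfolding y0 by (rule dV(1)[OF x])
  from has_derivative_compose[OF dy this]
  have "((\<lambda>t. u (y t)) has_real_derivative V x \<bullet> V x) (at 0)"
    unfolding has_field_derivative_def by (rule has_derivative_eq_rhs) (simp add: fun_eq_iff)
  then have "((\<lambda>t. u (y t) - t * (s * norm (V x))) has_real_derivative V x \<bullet> V x - 1 * (s * norm (V x))) (at 0)"
    by (intro DERIV_diff DERIV_cmult_right DERIV_ident)
  moreover have "V x \<bullet> V x - 1 * (s * norm (V x)) > 0"
  proof -
    have "s * norm (V x) < norm (V x) * norm (V x)" using s s0 by (intro mult_strict_right_mono) auto
    then show ?thesis by (simp add: dot_square_norm power2_eq_square)
  qed
  ultimately obtain d where d: "d > 0"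
    "\<And>h. h > 0 \<Longrightarrow> h < d \<Longrightarrow> u (y 0) - 0 * (s * norm (V x)) < u (y (0 + h)) - (0 + h) * (s * norm (V x))"
    using DERIV_pos_inc_right by blast
  have "(y \<longlongrightarrow> x) (at_right 0)"
    using has_derivative_continuous[OF dy] by (simp add: continuous_within y0 filterlim_at_split)
  then have "eventually (\<lambda>t. y t \<in> \<Omega>0) (at_right 0)" using topological_tendstoD[OF _ opn] x by blast
  moreover have "eventually (\<lambda>t. t \<in> {0<..<d}) (at_right 0)" by (rule eventually_at_right_real) (rule d)
  ultimately have "eventually (\<lambda>t. y t \<in> \<Omega>0 \<and> t \<in> {0<..<d}) (at_right 0)" by (rule eventually_conj)
  then obtain t where t: "y t \<in> \<Omega>0" "0 < t" "t < d" using eventually_happens'[of "at_right (0::real)"] by force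
  have "u (y t) \<le> u x + s * norm (y t - x)" unfolding s_def using x t by (intro slope_bound) auto
  moreover have "norm (y t - x) = t * norm (V x)" using t by (simp add: y_def)
  ultimately show False using d(2)[OF t(2,3)] y0 by (simp add: mult_ac)
qed

text \<open>On the steepest segment the derivative is \<open>- (1 / r)\<close>, so Du does not
  vanish identically.\<close>

lemma V_nonzero: "x \<in> \<Omega> \<Longrightarrow> V x \<noteq> 0"
proof -
  assume x: "x \<in> \<Omega>"
  obtain v where v: "norm v = 1" "\<And>t. 0 \<le> t \<Longrightarrow> t < r \<Longrightarrow> x0 + t *\<^sub>R v \<in> \<Omega>0"
    "\<And>t. 0 \<le> t \<Longrightarrow> t < r \<Longrightarrow> u (x0 + t *\<^sub>R v) = 1 - t / r" using steepest_segment by blast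
  define w where "w = x0 + (r / 2) *\<^sub>R v"
  have w: "w \<in> \<Omega>" using v(2)[of "r / 2"] r_pos v(1) by (auto simp: w_def)
  have dl: "((\<lambda>t. x0 + t *\<^sub>R v) has_derivative (\<lambda>t. t *\<^sub>R v)) (at (r / 2))"
    by (auto intro!: derivative_eq_intros)
  from has_derivative_compose[OF dl dV(1)[OF w, unfolded w_def], folded w_def]
  have "((\<lambda>t. u (x0 + t *\<^sub>R v)) has_real_derivative V w \<bullet> v) (at (r / 2))"
    unfolding has_field_derivative_def by (rule has_derivative_eq_rhs) (simp add: fun_eq_iff)
  then have "((\<lambda>t. 1 - t / r) has_real_derivative V w \<bullet> v) (at (r / 2))"
    by (rule has_field_derivative_transform_within_open[of _ _ _ "{0<..<r}"]) (use v(3) r_pos in auto)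
  moreover have "((\<lambda>t. 1 - t / r) has_real_derivative - (1 / r)) (at (r / 2))"
    using r_pos by (auto intro!: derivative_eq_intros)
  ultimately have "V w \<bullet> v = - (1 / r)" by (rule DERIV_unique)
  then have "V w \<noteq> 0" using r_pos by auto
  then show ?thesis using inf_harmonic_C2_no_critical_points[OF C open_\<Omega> connected_\<Omega> lap w _ x] by blast
qed

text \<open>An interior zero would be a minimum, hence a critical point.\<close>

lemma u_pos: "x \<in> \<Omega> \<Longrightarrow> 0 < u x"
proof (rule ccontr)
  assume x: "x \<in> \<Omega>" and "\<not> ?thesis"
  then have "u x = 0" using u_nonneg[of x] by auto
  then have "\<forall>y\<in>\<Omega>. u x \<le> u y" using u_nonneg by auto
  then have "(\<lambda>h. V x \<bullet> h) = (\<lambda>h. 0)"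
    using differential_zero_maxmin[OF x open_\<Omega> dV(1)[OF x]] by blast
  then have "V x \<bullet> V x = 0" by meson
  then show False using V_nonzero[OF x] by simp
qed

text \<open>The band is taken in the closure to be compact. For \<open>0 < a\<close> and
  \<open>b < 1\<close> it avoids the frontier and the pole, where \<open>u\<close> is 0 and
  1.\<close>

definition G where "G a b = {x \<in> closure \<Omega>0. a \<le> u x \<and> u x \<le> b}"

lemma G_subset: "0 < a \<Longrightarrow> b < 1 \<Longrightarrow> G a b \<subseteq> \<Omega>"
proof
  fix x assume ab: "0 < a" "b < 1" and x: "x \<in> G a b"
  then have "x \<notin> frontier \<Omega>0" using u_frontier[of x] by (auto simp: G_def)
  moreover have "x \<noteq> x0" using x ab u_x0 by (auto simp: G_def)
  ultimately show "x \<in> \<Omega>" using x opn by (auto simp: G_def frontier_def interior_open)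
qed

lemma G_eq: "0 < a \<Longrightarrow> b < 1 \<Longrightarrow> G a b = {x \<in> \<Omega>. a \<le> u x \<and> u x \<le> b}"
  using G_subset[of a b] closure_subset[of \<Omega>0] by (auto simp: G_def)

lemma compact_G: "compact (G a b)"
proof -
  have "closed (closure \<Omega>0 \<inter> u -` {a..b})"
    by (rule continuous_closed_preimage[OF cont]) auto
  moreover have "G a b = closure \<Omega>0 \<inter> u -` {a..b}" by (auto simp: G_def)
  ultimately have "closed (G a b)" by simp
  then show ?thesis
    using bounded_subset[OF bounded_closure[OF bnd], of "G a b"] by (auto simp: compact_eq_bounded_closed G_def)
qed

lemma level_min_critical:
  fixes \<Phi> :: "real^'n \<Rightarrow> real"
  assumes ab: "0 < a" "b < 1" and p: "p \<in> \<Omega>" "a < u p" "u p < b"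
    and min: "\<And>y. y \<in> G a b \<Longrightarrow> \<Phi> p \<le> \<Phi> y" and d: "(\<Phi> has_derivative \<Phi>') (at p)"
  shows "\<Phi>' h = 0"
proof -
  have "continuous_on \<Omega> u" by (rule C2_data_continuous(1)[OF C])
  then have "open (\<Omega> \<inter> u -` {a<..<b})" by (rule continuous_open_preimage[OF _ open_\<Omega> open_greaterThanLessThan])
  moreover have "p \<in> \<Omega> \<inter> u -` {a<..<b}" using p by auto
  moreover have "\<forall>y\<in>\<Omega> \<inter> u -` {a<..<b}. \<Phi> p \<le> \<Phi> y" using min ab by (auto simp: G_eq)
  ultimately have "\<Phi>' = (\<lambda>h. 0)" by (intro differential_zero_maxmin[OF _ _ d] disjI2)
  then show ?thesis by simp
qed

section \<open>Minimum principles for the squared gradient\<close>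

definition q where "q x = V x \<bullet> V x"

lemma q_pos: "x \<in> \<Omega> \<Longrightarrow> q x > 0" using V_nonzero by (simp add: q_def)

lemma cont_u: "continuous_on \<Omega> u" and cont_V: "continuous_on \<Omega> V"
  using C2_data_continuous[OF C] by auto

lemma cont_q: "continuous_on \<Omega> q"
  unfolding q_def by (intro continuous_intros cont_V)

lemma exp_u_derivative:
  assumes x: "x \<in> \<Omega>"
  shows "((\<lambda>y. exp (N * (u y - b))) has_derivative (\<lambda>h. N * exp (N * (u x - b)) * (V x \<bullet> h))) (at x)"
  by (rule has_derivative_eq_rhs, (rule derivative_intros dV(1)[OF x])+) (simp add: fun_eq_iff)

text \<open>At an interior minimum of \<open>|Du|\<^sup>2 + \<kappa> exp (N (u - b))\<close> the derivative in direction \<open>Du\<close>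
  equals \<open>\<kappa> N exp (N (u - b)) |Du|\<^sup>2 \<noteq> 0\<close>.\<close>

lemma level_grad_le:
  assumes x: "x \<in> \<Omega>" and b: "0 < b" "b < 1"
  shows "\<exists>y\<in>\<Omega>. u y = b \<and> q y \<le> q x"
proof (rule ccontr)
  assume "\<not> ?thesis"
  then have neg: "\<And>y. y \<in> \<Omega> \<Longrightarrow> u y = b \<Longrightarrow> q x < q y" by force
  define a where "a = u x"
  have a: "0 < a" "a < 1" using u_pos[OF x] u_less_one[of x] x by (auto simp: a_def)
  have ab: "a \<noteq> b" using neg[OF x] by (auto simp: a_def)
  have "\<exists>\<kappa>>0. \<forall>y\<in>\<Omega>. u y = b \<longrightarrow> q x + 2 * \<kappa> \<le> q y"
  proof (cases "G b b = {}")
    \<comment> \<open>An empty level admits any \<open>\<kappa>\<close>, so the contradiction below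
      also shows that the level is attained.\<close>
    case True
    then show ?thesis using G_eq[OF b] by (auto intro!: exI[of _ 1])
  next
    case False
    have "continuous_on (G b b) q" using cont_q G_subset[OF b] continuous_on_subset by blast
    then obtain s where s: "s \<in> G b b" "\<And>y. y \<in> G b b \<Longrightarrow> q s \<le> q y"
      using continuous_attains_inf[OF compact_G False] by blast
    have qs: "q x < q s" using neg[of s] s(1) by (auto simp: G_eq[OF b])
    have "q s \<le> q y" if "y \<in> \<Omega>" "u y = b" for y using s(2)[of y] that by (simp add: G_eq[OF b])
    moreover have "q x + 2 * ((q s - q x) / 2) = q s" by (simp add: field_simps)
    ultimately have "\<forall>y\<in>\<Omega>. u y = b \<longrightarrow> q x + 2 * ((q s - q x) / 2) \<le> q y" by presburger
    moreover have "(q s - q x) / 2 > 0" using qs by simp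
    ultimately show ?thesis by blast
  qed
  then obtain \<kappa> where \<kappa>: "\<kappa> > 0" "\<And>y. y \<in> \<Omega> \<Longrightarrow> u y = b \<Longrightarrow> q x + 2 * \<kappa> \<le> q y" by blast
  \<comment> \<open>An auxiliary level on the side of \<open>a\<close> opposite to \<open>b\<close>,
    so that \<open>x\<close> is strictly inside the band.\<close>
  define a' where "a' = (if a < b then a / 2 else (1 + a) / 2)"
  define lo hi where "lo = min a' b" and "hi = max a' b"
  have lohi: "0 < lo" "lo < a" "a < hi" "hi < 1" and a': "a' \<noteq> a"
    using a b ab by (auto simp: lo_def hi_def a'_def)
  \<comment> \<open>The perturbation equals \<open>q x + 2 * \<kappa>\<close> on level
    \<open>a'\<close>, above the value \<open>q x + \<kappa>\<close> of \<open>\<Phi>\<close> at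
    \<open>x\<close>. The sign of \<open>N\<close> follows that of \<open>a' - a\<close>, which
    allows transport both up and down.\<close>
  define N where "N = ln ((q x + 2 * \<kappa>) / \<kappa>) / (a' - a)"
  have qx: "q x > 0" by (rule q_pos[OF x])
  have "(q x + 2 * \<kappa>) / \<kappa> > 1" using qx \<kappa> by simp
  then have N: "N \<noteq> 0" "\<kappa> * exp (N * (a' - a)) = q x + 2 * \<kappa>"
    using a' \<kappa> qx by (auto simp: N_def)
  define \<Phi> where "\<Phi> y = q y + \<kappa> * exp (N * (u y - a))" for y
  have "continuous_on (G lo hi) \<Phi>"
    unfolding \<Phi>_def using G_subset[OF lohi(1,4)]
    by (intro continuous_intros continuous_on_subset[OF cont_q] continuous_on_subset[OF cont_u])
  moreover have xG: "x \<in> G lo hi" using x lohi by (auto simp: G_eq a_def)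
  ultimately obtain p where p: "p \<in> G lo hi" "\<And>y. y \<in> G lo hi \<Longrightarrow> \<Phi> p \<le> \<Phi> y"
    using continuous_attains_inf[OF compact_G, of lo hi \<Phi>] by blast
  have p\<Omega>: "p \<in> \<Omega>" using p G_subset[OF lohi(1,4)] by blast
  have "\<Phi> p \<le> q x + \<kappa>" using p(2)[OF xG] by (simp add: \<Phi>_def a_def)
  moreover have "\<Phi> p > q x + \<kappa>" if "u p = b"
  proof -
    have "0 < \<kappa> * exp (N * (u p - a))" using \<kappa>(1) by simp
    then show ?thesis using \<kappa>(2)[OF p\<Omega> that] \<kappa>(1) unfolding \<Phi>_def by linarith
  qed
  moreover have "\<Phi> p > q x + \<kappa>" if "u p = a'"
    using q_pos[OF p\<Omega>] N(2) \<kappa>(1) that by (simp add: \<Phi>_def)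
  ultimately have "u p \<noteq> a'" "u p \<noteq> b" by auto
  then have pint: "lo < u p" "u p < hi" using p(1) by (auto simp: G_def lo_def hi_def)
  have "(\<Phi> has_derivative (\<lambda>h. 2 * (V p \<bullet> H p h) + \<kappa> * (N * exp (N * (u p - a)) * (V p \<bullet> h)))) (at p)"
    unfolding \<Phi>_def q_def
    by (intro has_derivative_add has_derivative_mult_right dq[OF p\<Omega>] exp_u_derivative[OF p\<Omega>])
  from level_min_critical[OF lohi(1,4) p\<Omega> pint p(2) this, of "V p"]
  have "\<kappa> * (N * exp (N * (u p - a)) * (V p \<bullet> V p)) = 0" using lap[OF p\<Omega>] by simp
  then show False using \<kappa>(1) N(1) V_nonzero[OF p\<Omega>] by simp
qed

text \<open>By \<open>level_grad_le\<close> the minimum over a single level is the global one, and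
  starting from its minimiser every other level attains it as well.\<close>

lemma grad_min_on_levels:
  obtains q0 where "q0 > 0" "\<And>x. x \<in> \<Omega> \<Longrightarrow> q0 \<le> q x"
    "\<And>b. 0 < b \<Longrightarrow> b < 1 \<Longrightarrow> \<exists>y\<in>\<Omega>. u y = b \<and> q y = q0"
proof -
  obtain v where v: "norm v = 1" "\<And>t. 0 \<le> t \<Longrightarrow> t < r \<Longrightarrow> x0 + t *\<^sub>R v \<in> \<Omega>0"
    "\<And>t. 0 \<le> t \<Longrightarrow> t < r \<Longrightarrow> u (x0 + t *\<^sub>R v) = 1 - t / r" using steepest_segment by blast
  have "x0 + (r / 2) *\<^sub>R v \<in> \<Omega>" using v(2)[of "r / 2"] r_pos v(1) by auto
  then obtain z where "z \<in> \<Omega>" "u z = 1/2" using level_grad_le[of "x0 + (r / 2) *\<^sub>R v" "1/2"] by auto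
  then have "z \<in> G (1/2) (1/2)" by (simp add: G_eq)
  then have ne: "G (1/2) (1/2) \<noteq> {}" by blast
  have "G (1/2) (1/2) \<subseteq> \<Omega>" by (rule G_subset) auto
  then have "continuous_on (G (1/2) (1/2)) q" using cont_q continuous_on_subset by blast
  then obtain s where s: "s \<in> G (1/2) (1/2)" "\<And>y. y \<in> G (1/2) (1/2) \<Longrightarrow> q s \<le> q y"
    using continuous_attains_inf[OF compact_G ne] by blast
  have s\<Omega>: "s \<in> \<Omega>" using s(1) \<open>G (1/2) (1/2) \<subseteq> \<Omega>\<close> by blast
  have le: "q s \<le> q x" if x: "x \<in> \<Omega>" for x
  proof -
    obtain y where y: "y \<in> \<Omega>" "u y = 1/2" "q y \<le> q x" using level_grad_le[OF x, of "1/2"] by auto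
    then have "y \<in> G (1/2) (1/2)" by (simp add: G_eq)
    then show ?thesis using s(2)[of y] y(3) by linarith
  qed
  show ?thesis
  proof (rule that[of "q s"])
    show "\<exists>y\<in>\<Omega>. u y = b \<and> q y = q s" if "0 < b" "b < 1" for b
      using level_grad_le[OF s\<Omega> that] le by (meson order_antisym)
  qed (use q_pos[OF s\<Omega>] le in auto)
qed

text \<open>The function \<open>1 - u + Du \<cdot> (x - x0)\<close> is constant along the gradient curves on which \<open>|Du|\<close> is
  minimal, since these are straight; as it vanishes at \<open>x0\<close>, it vanishes on them.\<close>

lemma grad_min_radial:
  assumes q0: "q0 > 0" "\<And>x. x \<in> \<Omega> \<Longrightarrow> q0 \<le> q x"
    "\<And>b. 0 < b \<Longrightarrow> b < 1 \<Longrightarrow> \<exists>y\<in>\<Omega>. u y = b \<and> q y = q0"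
    and b: "0 < b" "b < 1" and \<eta>: "\<eta> > 0"
  shows "\<exists>y\<in>\<Omega>. u y = b \<and> q y \<le> q0 + \<eta> \<and> 1 - u y + V y \<bullet> (y - x0) \<le> \<eta>"
proof (rule ccontr)
  assume neg: "\<not> ?thesis"
  \<comment> \<open>The error at the pole of the first order Taylor polynomial of \<open>u\<close>
    at \<open>y\<close>.\<close>
  define R where "R y = 1 - u y + V y \<bullet> (y - x0)" for y
  have R: "\<bar>R y\<bar> \<le> 2 * (1 - u y)" "\<bar>R y\<bar> \<le> 2" if "y \<in> \<Omega>" for y
  proof -
    have "\<bar>V y \<bullet> (y - x0)\<bar> \<le> 1 - u y"
      using Cauchy_Schwarz_ineq2[of "V y" "y - x0"] norm_V_le[OF that] by linarith
    then show "\<bar>R y\<bar> \<le> 2 * (1 - u y)" "\<bar>R y\<bar> \<le> 2"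
      unfolding R_def using u_nonneg[of y] that by auto
  qed
  \<comment> \<open>A level so close to 1 that \<open>R\<close> is at most \<open>\<eta> / 8\<close>
    on it. Its point of minimal gradient is the competitor against which the minimum is
    measured.\<close>
  define b' where "b' = max ((1 + b) / 2) (1 - \<eta> / 16)"
  have b': "b < b'" "0 < b'" "b' < 1" "2 * (1 - b') \<le> \<eta> / 8" using b \<eta> by (auto simp: b'_def max_def field_simps)
  obtain x' where x': "x' \<in> \<Omega>" "u x' = b'" "q x' = q0" using q0(3)[OF b'(2,3)] by blast
  define a' where "a' = (1 + b') / 2"
  have a': "b' < a'" "a' < 1" using b' by (auto simp: a'_def)
  define \<kappa> where "\<kappa> = \<eta> / 4"
  have \<kappa>: "\<kappa> > 0" using \<eta> by (simp add: \<kappa>_def)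
  \<comment> \<open>Makes the exponential equal to \<open>3 + \<eta>\<close> on the upper level,
    which excludes a minimum there although \<open>R\<close> may be as low as -2.\<close>
  define N where "N = ln ((3 + \<eta>) / \<kappa>) / (a' - b')"
  have "(3 + \<eta>) / \<kappa> > 1" using \<eta> by (simp add: \<kappa>_def)
  then have N: "N > 0" "\<kappa> * exp (N * (a' - b')) = 3 + \<eta>"
    using a' \<kappa> \<eta> by (auto simp: N_def)
  define K where "K = G b a'"
  have K\<Omega>: "K \<subseteq> \<Omega>" unfolding K_def using b a' by (intro G_subset)
  have cK: "compact K" unfolding K_def by (rule compact_G)
  have x'K: "x' \<in> K" using x' b' a' b by (auto simp: K_def G_eq)
  define E where "E y = \<kappa> * (N * exp (N * (u y - b')))" for y
  have E: "E y > 0" for y using \<kappa> N by (simp add: E_def)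
  define W where "W y = H y (y - x0) \<bullet> (y - x0) + E y * (V y \<bullet> (y - x0))" for y
  have cH: "continuous_on K (\<lambda>y. H y (y - x0))"
    unfolding continuous_on_def
    using K\<Omega> by (auto intro!: C2_data_tendsto[OF C open_\<Omega>] tendsto_intros)
  have "continuous_on K W"
    unfolding W_def E_def
    by (intro continuous_intros cH continuous_on_subset[OF cont_u K\<Omega>] continuous_on_subset[OF cont_V K\<Omega>])
  then obtain w where w: "w \<in> K" "\<And>y. y \<in> K \<Longrightarrow> W y \<le> W w"
    using continuous_attains_sup[OF cK, of W] x'K by blast
  define B where "B = max (W w) 1"
  have B: "B > 0" "\<And>y. y \<in> K \<Longrightarrow> W y \<le> B" using w(2) by (auto simp: B_def max.coboundedI1)
  define l where "l = \<kappa> * (N * exp (N * (b - b'))) * q0"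
  have l: "l > 0" using \<kappa> N q0 by (simp add: l_def)
  have lE: "l \<le> E y * q y" if "y \<in> K" for y
    unfolding l_def E_def
  proof (rule mult_mono)
    show "\<kappa> * (N * exp (N * (b - b'))) \<le> \<kappa> * (N * exp (N * (u y - b')))"
      using that \<kappa> N by (auto simp: K_def G_def)
    show "q0 \<le> q y" using q0(2) that K\<Omega> by blast
  qed (use \<kappa> N q0 in auto)
  \<comment> \<open>The first bound excludes a minimum on level \<open>b\<close> where
    \<open>q\<close> exceeds \<open>q0 + \<eta>\<close>; the second makes
    \<open>\<epsilon> * W\<close> at most the lower bound \<open>l\<close> of \<open>E * q\<close>,
    half of what the critical point equation requires.\<close>
  define \<epsilon> where "\<epsilon> = min (\<eta> / (\<eta> + 2)) (l / B)"
  have \<epsilon>: "\<epsilon> > 0" "\<epsilon> * (\<eta> + 2) \<le> \<eta>" "\<epsilon> * B \<le> l"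
  proof -
    show "\<epsilon> > 0" using \<eta> l B by (simp add: \<epsilon>_def)
    have "\<epsilon> \<le> \<eta> / (\<eta> + 2)" "\<epsilon> \<le> l / B" by (simp_all add: \<epsilon>_def)
    then show "\<epsilon> * (\<eta> + 2) \<le> \<eta>" "\<epsilon> * B \<le> l" using \<eta> B by (simp_all add: le_divide_eq)
  qed
  define \<Phi> where "\<Phi> y = q y + \<epsilon> * (R y + \<kappa> * exp (N * (u y - b')))" for y
  have "continuous_on K \<Phi>"
    unfolding \<Phi>_def R_def
    by (intro continuous_intros continuous_on_subset[OF cont_q K\<Omega>] continuous_on_subset[OF cont_u K\<Omega>]
        continuous_on_subset[OF cont_V K\<Omega>])
  then obtain p where p: "p \<in> K" "\<And>y. y \<in> K \<Longrightarrow> \<Phi> p \<le> \<Phi> y"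
    using continuous_attains_inf[OF cK, of \<Phi>] x'K by blast
  have p\<Omega>: "p \<in> \<Omega>" using p K\<Omega> by blast
  have up: "\<Phi> p < q0 + \<epsilon> * \<eta>"
  proof -
    have "\<bar>R x'\<bar> \<le> \<eta> / 8" using R(1)[OF x'(1)] x'(2) b'(4) by simp
    then have "R x' + \<kappa> < \<eta>" using \<eta> by (simp add: \<kappa>_def)
    then have "\<epsilon> * (R x' + \<kappa>) < \<epsilon> * \<eta>" using \<epsilon>(1) by (rule mult_strict_left_mono)
    then show ?thesis using p(2)[OF x'K] x' by (simp add: \<Phi>_def)
  qed
  have Rp: "R p \<ge> - 2" using R(2)[OF p\<Omega>] by linarith
  have qp: "q0 \<le> q p" by (rule q0(2)[OF p\<Omega>])
  have "u p \<noteq> a'"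
  proof
    assume "u p = a'"
    then have "\<Phi> p = q p + \<epsilon> * (R p + (3 + \<eta>))" using N(2) by (simp add: \<Phi>_def)
    moreover have "\<epsilon> * \<eta> \<le> \<epsilon> * (R p + (3 + \<eta>))" using Rp \<epsilon>(1) by (intro mult_left_mono) auto
    ultimately show False using up qp by linarith
  qed
  moreover have "u p \<noteq> b"
  proof
    assume ub: "u p = b"
    have ex: "\<kappa> * exp (N * (u p - b')) > 0" using \<kappa> by simp
    consider "q p > q0 + \<eta>" | "R p > \<eta>" using neg p\<Omega> ub by (fastforce simp: R_def)
    then show False
    proof cases
      case 1
      have "\<epsilon> * (- 2) \<le> \<epsilon> * (R p + \<kappa> * exp (N * (u p - b')))"
        using Rp ex \<epsilon>(1) by (intro mult_left_mono) auto
      then show False using 1 up \<epsilon>(2) unfolding \<Phi>_def by (simp add: distrib_left)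
    next
      case 2
      have "\<epsilon> * \<eta> \<le> \<epsilon> * (R p + \<kappa> * exp (N * (u p - b')))"
        using 2 ex \<epsilon>(1) by (intro mult_left_mono) auto
      then show False using up qp unfolding \<Phi>_def by linarith
    qed
  qed
  ultimately have pint: "b < u p" "u p < a'" using p(1) by (auto simp: K_def G_def)
  have dR: "(R has_derivative (\<lambda>h. H p h \<bullet> (p - x0))) (at p)"
  proof -
    have "(R has_derivative (\<lambda>h. 0 - V p \<bullet> h + (V p \<bullet> (h - 0) + H p h \<bullet> (p - x0)))) (at p)"
      unfolding R_def
      by (intro has_derivative_add has_derivative_diff has_derivative_const has_derivative_inner
          has_derivative_ident dV[OF p\<Omega>])
    then show ?thesis by simp
  qed
  have "(\<Phi> has_derivative (\<lambda>h. 2 * (V p \<bullet> H p h) + \<epsilon> * (H p h \<bullet> (p - x0)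
      + \<kappa> * (N * exp (N * (u p - b')) * (V p \<bullet> h))))) (at p)"
    unfolding \<Phi>_def q_def
    by (intro has_derivative_add has_derivative_mult_right dq[OF p\<Omega>] exp_u_derivative[OF p\<Omega>] dR)
  from level_min_critical[OF b(1) a'(2) p\<Omega> pint p(2)[unfolded K_def] this]
  have crit: "2 * (V p \<bullet> H p h) + \<epsilon> * (H p h \<bullet> (p - x0) + E p * (V p \<bullet> h)) = 0" for h
    by (simp add: E_def mult.assoc)
  \<comment> \<open>The derivative of \<open>R\<close> along Du is half the derivative of |Du|^2
    along \<open>p - x0\<close>. Testing the critical point equation in both directions and using
    the symmetry of \<open>H\<close> eliminates this common term.\<close>
  have 1: "H p (V p) \<bullet> (p - x0) = - (E p * q p)"
    using crit[of "V p"] lap[OF p\<Omega>] \<epsilon>(1) by (simp add: q_def)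
  have "2 * (V p \<bullet> H p (p - x0)) + \<epsilon> * W p = 0"
    using crit[of "p - x0"] by (simp add: W_def)
  then have "2 * (E p * q p) = \<epsilon> * W p"
    using 1 C2_data_symmetric[OF C open_\<Omega> p\<Omega>, of "V p" "p - x0"] by simp
  also have "\<dots> \<le> \<epsilon> * B" using B(2)[OF p(1)] \<epsilon>(1) by (intro mult_left_mono) auto
  finally show False using lE[OF p(1)] \<epsilon>(3) l by linarith
qed

lemma C2_rigidity: "\<Omega>0 = ball x0 r"
proof -
  obtain q0 where q0: "q0 > 0" "\<And>x. x \<in> \<Omega> \<Longrightarrow> q0 \<le> q x"
    "\<And>b. 0 < b \<Longrightarrow> b < 1 \<Longrightarrow> \<exists>y\<in>\<Omega>. u y = b \<and> q y = q0" using grad_min_on_levels by blast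
  have key: "m \<le> sqrt q0" if m: "0 < m" "m < 1 / r" for m
  proof -
    obtain d where d: "d > 0" "\<And>y. y \<noteq> x0 \<Longrightarrow> norm (y - x0) < d \<Longrightarrow> m \<le> slope y"
      using asymptotic_slope[OF card m(2)] unfolding eventually_at by (auto simp: dist_norm)
    obtain \<mu> where \<mu>: "\<mu> > 0" "\<And>x. x \<in> \<Omega>0 \<Longrightarrow> x \<noteq> x0 \<Longrightarrow> \<mu> \<le> slope x" using slope_lower_bound by blast
    \<comment> \<open>The positive lower bound \<open>\<mu>\<close> of the slope confines the level
      \<open>b\<close> to the ball of radius \<open>d\<close>, where the asymptotic bound
      holds.\<close>
    define b where "b = max (1/2) (1 - \<mu> * d / 2)"
    have b: "0 < b" "b < 1" "1 - b < \<mu> * d" using \<mu> d by (auto simp: b_def max_def)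
    have near: "m * norm (y - x0) \<le> 1 - b" if y: "y \<in> \<Omega>" "u y = b" for y
    proof -
      have n: "norm (y - x0) > 0" using y by simp
      have "\<mu> * norm (y - x0) \<le> 1 - b" using \<mu>(2)[of y] y n by (simp add: slope_def le_divide_eq)
      then have "\<mu> * norm (y - x0) < \<mu> * d" using b by linarith
      then have "norm (y - x0) < d" using \<mu> by simp
      then show ?thesis using d(2)[of y] y n by (simp add: slope_def le_divide_eq)
    qed
    \<comment> \<open>On this level the almost radial point has |Du| |y - x0| nearly equal to 1 - b,
      while the slope bound makes |y - x0| at most (1 - b) / m.\<close>
    have ineq: "m * (1 - b - \<eta>) \<le> sqrt (q0 + \<eta>) * (1 - b)" if \<eta>: "\<eta> > 0" for \<eta>
    proof -
      obtain y where y: "y \<in> \<Omega>" "u y = b" "q y \<le> q0 + \<eta>" "1 - u y + V y \<bullet> (y - x0) \<le> \<eta>"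
        using grad_min_radial[OF q0 b(1,2) \<eta>] by blast
      have "1 - b - \<eta> \<le> - (V y \<bullet> (y - x0))" using y by simp
      also have "\<dots> \<le> norm (V y) * norm (y - x0)" using Cauchy_Schwarz_ineq2[of "V y" "y - x0"] by linarith
      also have "norm (V y) = sqrt (q y)" by (simp add: q_def norm_eq_sqrt_inner)
      also have "sqrt (q y) * norm (y - x0) \<le> sqrt (q0 + \<eta>) * norm (y - x0)"
        using y(3) by (intro mult_right_mono) auto
      finally have "m * (1 - b - \<eta>) \<le> m * (sqrt (q0 + \<eta>) * norm (y - x0))" using m by (intro mult_left_mono) auto
      also have "\<dots> = sqrt (q0 + \<eta>) * (m * norm (y - x0))" by simp
      also have "\<dots> \<le> sqrt (q0 + \<eta>) * (1 - b)" using near[OF y(1,2)] q0(1) \<eta> by (intro mult_left_mono) auto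
      finally show ?thesis .
    qed
    have "((\<lambda>\<eta>. m * (1 - b - \<eta>)) \<longlongrightarrow> m * (1 - b - 0)) (at_right 0)" by (intro tendsto_intros)
    moreover have "((\<lambda>\<eta>. sqrt (q0 + \<eta>) * (1 - b)) \<longlongrightarrow> sqrt (q0 + 0) * (1 - b)) (at_right 0)"
      by (intro tendsto_intros)
    moreover have "eventually (\<lambda>\<eta>. m * (1 - b - \<eta>) \<le> sqrt (q0 + \<eta>) * (1 - b)) (at_right 0)"
      using eventually_at_right_less[of "0::real"] by (rule eventually_mono) (rule ineq)
    ultimately have "m * (1 - b - 0) \<le> sqrt (q0 + 0) * (1 - b)"
      by (intro tendsto_le[of "at_right (0::real)"]) auto
    then show ?thesis using b by simp
  qed
  have "1 / r \<le> sqrt q0"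
  proof (rule ccontr)
    assume "\<not> ?thesis"
    then obtain m where "sqrt q0 < m" "m < 1 / r" using dense[of "sqrt q0" "1 / r"] by auto
    moreover have "0 < m" using calculation(1) q0(1) real_sqrt_gt_zero[of q0] by linarith
    ultimately show False using key[of m] by simp
  qed
  show ?thesis
  proof (rule ball_rigidity)
    fix x assume x: "x \<in> \<Omega>0" "x \<noteq> x0"
    have "sqrt q0 \<le> sqrt (q x)" using q0(2) x by simp
    also have "sqrt (q x) = norm (V x)" by (simp add: q_def norm_eq_sqrt_inner)
    finally have "1 / r * norm (x - x0) \<le> norm (V x) * norm (x - x0)"
      using \<open>1 / r \<le> sqrt q0\<close> by (intro mult_right_mono) auto
    then show "norm (x - x0) / r \<le> 1 - u x" using norm_V_le[of x] x by simp
  qed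
qed

end

section \<open>Equivalence of ball, smoothness and concavity\<close>

theorem theorem1p4:
  fixes \<Omega>0 :: "(real^'n) set" and x0 :: "real^'n" and u :: "real^'n \<Rightarrow> real"
  assumes "CARD('n) \<ge> 2"
    and "open \<Omega>0" and "connected \<Omega>0" and "bounded \<Omega>0" and "convex \<Omega>0"
    and "x0 \<in> \<Omega>0"
    and "inf_harmonic_potential \<Omega>0 x0 u"
  shows "((\<exists>r>0. \<Omega>0 = ball x0 r) \<longleftrightarrow> C2_on (\<Omega>0 - {x0}) u)
       \<and> (C2_on (\<Omega>0 - {x0}) u \<longleftrightarrow> concave_on \<Omega>0 u)"
proof -
  interpret inf_potential \<Omega>0 x0 u using assms by unfold_locales auto
  have C2: "C2_on (\<Omega>0 - {x0}) u" if \<rho>: "\<rho> > 0" "\<Omega>0 = ball x0 \<rho>" for \<rho>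
  proof -
    \<comment> \<open>The explicit potential in the form of \<open>C2_data_cone\<close>, with zero
      tilt and zero quadratic part.\<close>
    let ?f = "\<lambda>x. 1 + 0 \<bullet> x + (- (1 / \<rho>)) * norm (x - x0) + 0 * (norm (x - x0))\<^sup>2"
    let ?S = "\<Omega>0 - {x0}"
    have eq: "?f x = u x" if "x \<in> \<Omega>0" for x using ball_potential[OF \<rho> that] by simp
    have op: "open ?S" using assms(2) by (simp add: open_delete)
    obtain g H where gH: "C2_data (- {x0}) ?f g H" using C2_data_cone by blast
    have "C2_data ?S u g H"
      unfolding C2_data_def
    proof (intro conjI ballI allI)
      fix x assume x: "x \<in> ?S"
      show "(u has_derivative (\<lambda>h. g x \<bullet> h)) (at x)"
        by (rule has_derivative_transform_within_open[OF C2_dataD(1)[OF gH] op x]) (use x eq in auto)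
      show "(g has_derivative H x) (at x)" using C2_dataD(2)[OF gH] x by simp
    next
      fix v
      have "continuous_on (- {x0}) (\<lambda>x. H x v)" using gH by (simp add: C2_data_def)
      then show "continuous_on ?S (\<lambda>x. H x v)" by (rule continuous_on_subset) auto
    qed
    then show ?thesis by (auto simp: C2_on_def)
  qed
  have conc: "concave_on \<Omega>0 u" if \<rho>: "\<rho> > 0" "\<Omega>0 = ball x0 \<rho>" for \<rho>
    unfolding concave_on_iff
  proof (intro conjI ballI allI impI)
    show "convex \<Omega>0" by (rule assms(5))
    fix x y and a b :: real
    assume x: "x \<in> \<Omega>0" and y: "y \<in> \<Omega>0" and ab: "0 \<le> a" "0 \<le> b" "a + b = 1"
    have z: "a *\<^sub>R x + b *\<^sub>R y \<in> \<Omega>0" using convexD[OF assms(5) x y ab] .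
    have "a *\<^sub>R x + b *\<^sub>R y - x0 = a *\<^sub>R (x - x0) + b *\<^sub>R (y - x0)"
    proof -
      have "x0 = (a + b) *\<^sub>R x0" using ab by simp
      then show ?thesis by (simp add: algebra_simps)
    qed
    then have "norm (a *\<^sub>R x + b *\<^sub>R y - x0) \<le> a * norm (x - x0) + b * norm (y - x0)"
      using norm_triangle_ineq[of "a *\<^sub>R (x - x0)" "b *\<^sub>R (y - x0)"] ab by simp
    then have "norm (a *\<^sub>R x + b *\<^sub>R y - x0) / \<rho> \<le> (a * norm (x - x0) + b * norm (y - x0)) / \<rho>"
      using \<rho> by (intro divide_right_mono) auto
    moreover have "a * (1 - norm (x - x0) / \<rho>) + b * (1 - norm (y - x0) / \<rho>)
        = (a + b) - (a * norm (x - x0) + b * norm (y - x0)) / \<rho>"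
      by (simp add: algebra_simps add_divide_distrib)
    ultimately show "a * u x + b * u y \<le> u (a *\<^sub>R x + b *\<^sub>R y)"
      unfolding ball_potential[OF \<rho> x] ball_potential[OF \<rho> y] ball_potential[OF \<rho> z] using ab by linarith
  qed
  have "\<exists>r>0. \<Omega>0 = ball x0 r" if smooth: "C2_on (\<Omega>0 - {x0}) u"
  proof -
    obtain V H where "C2_data (\<Omega>0 - {x0}) u V H" using smooth unfolding C2_on_def by blast
    then interpret C2_potential \<Omega>0 x0 u V H using assms by unfold_locales auto
    show ?thesis using C2_rigidity r_pos by blast
  qed
  moreover have "\<exists>r>0. \<Omega>0 = ball x0 r" if "concave_on \<Omega>0 u"
    using concave_imp_ball[OF assms(1) that] r_pos by blast
  ultimately show ?thesis using C2 conc by blast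
qed

end
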